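(* Let $N\ge 2$ be an integer and $m\in\mathbb{Z}$. Then \[ \langle W_m\rangle^{{\rm SU}(N)_{-N}}(q)=\begin{cases}(-1)^{\ell(N-1)}q^{(N-1)\ell(\ell-1)/2}\dfrac{1-q^{\ell N}}{1-q^{\ell}}, & m=\ell N \text{ with } \ell\in\mathbb{Z},\\[2mm] 0, & m\not\equiv 0 \pmod N,\end{cases} \] where for $\ell=0$ the quotient $\frac{1-q^{\ell N}}{1-q^{\ell}}$ is understood as $1+q^{\ell}+\dots+q^{(N-1)\ell}=N$.
   Context: Let $|q|<1$ and write $(a;q)_\infty=\prod_{k\ge0}(1-aq^k)$. Let $s_1,\dots,s_{N-1}$ be variables and put $s_N:=(s_1\cdots s_{N-1})^{-1}$. Define \[ \langle W_m\rangle^{{\rm SU}(N)_{-N}}(q):=\frac{(q;q)_\infty^{N-1}}{N!}\oint\prod_{i=1}^{N-1}\frac{ds_i}{2\pi i s_i}\prod_{\substack{i,j=1\\ i\ne j}}^N(s_is_j^{-1};q)_\infty\sum_{i=1}^N s_i^m, \] where the integral denotes the constant term in $s_1,\dots,s_{N-1}$ of the integrand expanded as a formal Laurent series in the $s_i$ (coefficientwise a power series in $q$), equivalently the contour integral over the unit circles. *)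

theory Defs
  imports "HOL-Analysis.Analysis"
begin

definition qpoch_inf :: "complex \<Rightarrow> complex \<Rightarrow> complex" where
  "qpoch_inf a q = (\<Prod>k. 1 - a * q ^ k)"

text \<open>Points on the torus: s_i = exp(i theta_i) for i < N-1, and
  s_(N-1) (the paper's s_N) = (s_1 ... s_(N-1))^(-1). Indices are 0-based.\<close>
definition torus_pt :: "nat \<Rightarrow> (nat \<Rightarrow> real) \<Rightarrow> nat \<Rightarrow> complex" where
  "torus_pt N \<theta> i =
     (if i < N - 1 then cis (\<theta> i) else inverse (\<Prod>j<N - 1. cis (\<theta> j)))"

definition wilson_integrand :: "nat \<Rightarrow> int \<Rightarrow> complex \<Rightarrow> (nat \<Rightarrow> real) \<Rightarrow> complex" where
  "wilson_integrand N m q \<theta> =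
     (let s = torus_pt N \<theta> in
       (\<Prod>i<N. \<Prod>j\<in>{..<N} - {i}. qpoch_inf (s i / s j) q) * (\<Sum>i<N. s i powi m))"

text \<open>The contour integral over the unit circles, written as the normalised
  integral over angles theta in [0,2pi]^(N-1): ds/(2 pi i s) = d theta / (2 pi).\<close>
definition wilson_SU_minusN :: "nat \<Rightarrow> int \<Rightarrow> complex \<Rightarrow> complex" where
  "wilson_SU_minusN N m q =
     qpoch_inf q q ^ (N - 1) / of_nat (fact N) *
     (complex_of_real (1 / (2 * pi)) ^ (N - 1) *
      integral\<^sup>L (\<Pi>\<^sub>M i\<in>{..<N - 1}. restrict_space lborel {0..2 * pi})
                 (wilson_integrand N m q))"

end

theory Submission
  imports Defs "HOL-Combinatorics.Multiset_Permutations" "HOL-Computational_Algebra.Polynomial"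
begin

text \<open>On the torus, the density \<open>\<Prod>i\<noteq>j. (s i / s j; q)\<^sub>\<infinity>\<close> is the sum over all orderings of
  the variables of the theta product \<open>\<Prod>i<j. (s i / s j; q)\<^sub>\<infinity> (q s j / s i; q)\<^sub>\<infinity>\<close>, because
  the sum over all orderings of \<open>\<Prod>i<j. s i / (s i - s j)\<close> is 1. It therefore suffices to average
  \<open>s i\<^sup>m\<close> against a single theta product. For \<open>m\<close> not divisible by \<open>N\<close> this vanishes by degree.
  For \<open>m = l N\<close>, truncate each theta factor to \<open>(u; q)\<^sub>a (q / u; q)\<^sub>b\<close>; replacing \<open>s i\<close> by
  \<open>q\<^sup>-\<^sup>l s i\<close> produces \<open>s i\<^sup>m\<close> and a power of \<open>q\<close>, and trades \<open>a\<close> against \<open>b\<close>. Choosing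
  unequal truncation lengths for the factors involving \<open>s i\<close>, one is left with the
  constant term of the equal-parameter q-Dyson product. As in the proof of Karolyi and Nagy, that
  constant term is a Lagrange-interpolation sum over a grid of powers of \<open>q\<close> on which the product
  has a single non-zero value. Finally the truncation lengths tend to infinity.\<close>

section \<open>Homogeneous polynomials and the torus average\<close>

text \<open>Polynomials are kept as functions generated from monomials, so a claim linear in the
  polynomial is checked on monomials only. The degree index later singles out the one monomial with
  nonzero average.\<close>

inductive homog :: "nat \<Rightarrow> nat \<Rightarrow> ((nat \<Rightarrow> complex) \<Rightarrow> complex) \<Rightarrow> bool" for N where
  homog_monom: "homog N (\<Sum>i<N. e i) (\<lambda>x. \<Prod>i<N. x i ^ e i)"
| homog_add: "homog N D f \<Longrightarrow> homog N D g \<Longrightarrow> homog N D (\<lambda>x. f x + g x)"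
| homog_cmult: "homog N D f \<Longrightarrow> homog N D (\<lambda>x. c * f x)"

lemma homog_monom_mult:
  assumes "homog N D f"
  shows "homog N ((\<Sum>i<N. e i) + D) (\<lambda>x. (\<Prod>i<N. x i ^ e i) * f x)"
  using assms
proof (induction rule: homog.induct)
  case (homog_monom e')
  have "homog N (\<Sum>i<N. e i + e' i) (\<lambda>x. \<Prod>i<N. x i ^ (e i + e' i))"
    by (rule homog.homog_monom)
  then show ?case by (simp add: sum.distrib power_add prod.distrib)
next
  case (homog_add D f g)
  then show ?case by (simp add: distrib_left homog.homog_add)
next
  case (homog_cmult D f c)
  from homog.homog_cmult[OF homog_cmult.IH, of c] show ?case by (simp add: mult.left_commute)
qed

lemma homog_mult:
  assumes "homog N D f" "homog N E g"
  shows "homog N (D + E) (\<lambda>x. f x * g x)"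
  using assms(1)
proof (induction rule: homog.induct)
  case (homog_monom e)
  then show ?case by (rule homog_monom_mult[OF assms(2)])
next
  case (homog_add D f g)
  then show ?case by (simp add: distrib_right homog.homog_add)
next
  case (homog_cmult D f c)
  from homog.homog_cmult[OF homog_cmult.IH, of c] show ?case by (simp add: mult.assoc)
qed

lemma homog_const: "homog N 0 (\<lambda>x. c)"
  using homog.homog_cmult[OF homog.homog_monom[of N "\<lambda>_. 0"], of c] by simp

lemma homog_var:
  assumes "i < N"
  shows "homog N 1 (\<lambda>x. x i)"
proof -
  have "homog N (\<Sum>j<N. if j = i then 1 else 0) (\<lambda>x. \<Prod>j<N. x j ^ (if j = i then 1 else 0))"
    by (rule homog.homog_monom)
  moreover have "(\<Prod>j<N. x j ^ (if j = i then 1 else 0)) = x i" for x :: "nat \<Rightarrow> complex"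
  proof -
    have "(\<Prod>j<N. x j ^ (if j = i then 1 else 0)) = (\<Prod>j<N. if j = i then x j else 1)"
      by (intro prod.cong) auto
    then show ?thesis using assms by simp
  qed
  ultimately show ?thesis using assms by simp
qed

lemma homog_linear:
  assumes "i < N" "j < N"
  shows "homog N 1 (\<lambda>x. x i - x j * c)"
  using homog.homog_add[OF homog_var[OF assms(1)] homog.homog_cmult[OF homog_var[OF assms(2)], of "-c"]]
  by (simp add: algebra_simps)

lemma homog_prod:
  assumes "finite A" "\<And>a. a \<in> A \<Longrightarrow> homog N (D a) (f a)"
  shows "homog N (\<Sum>a\<in>A. D a) (\<lambda>x. \<Prod>a\<in>A. f a x)"
  using assms
proof (induction rule: finite_induct)
  case empty
  then show ?case by (simp add: homog_const)
next
  case (insert a A)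
  then show ?case by (simp add: homog_mult)
qed

lemma homog_scale:
  assumes "homog N D f"
  shows "homog N D (\<lambda>x. f (x(i := c * x i)))"
  using assms
proof (induction rule: homog.induct)
  case (homog_monom e)
  have "(\<Prod>j<N. (x(i := c * x i)) j ^ e j) = (\<Prod>j<N. if j = i then c ^ e i else 1) * (\<Prod>j<N. x j ^ e j)"
    for x by (subst prod.distrib[symmetric], intro prod.cong) (auto simp: power_mult_distrib)
  then show ?case by (simp only: homog.homog_cmult homog.homog_monom)
next
  case (homog_add D f g)
  then show ?case by (intro homog.homog_add)
next
  case (homog_cmult D f c)
  then show ?case by (intro homog.homog_cmult)
qed

section \<open>Permuting the variables\<close>

lemma bij_betw_perm_nth:
  assumes "xs \<in> permutations_of_set {..<N::nat}"
  shows "bij_betw (\<lambda>i. xs ! i) {..<N} {..<N}"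
proof -
  have *: "set xs = {..<N}" "distinct xs" using assms by (auto simp: permutations_of_set_def)
  then have "length xs = N" using distinct_card[of xs] by simp
  then show ?thesis using bij_betw_nth[OF *(2)] * by auto
qed

lemma monom_perm:
  assumes "xs \<in> permutations_of_set {..<N}"
  obtains e' where "\<And>x::nat \<Rightarrow> complex. (\<Prod>i<N. x (xs ! i) ^ e i) = (\<Prod>i<N. x i ^ e' i)"
    "(\<Sum>i<N. e i) = (\<Sum>i<N. e' i)" "\<And>i. i < N \<Longrightarrow> e i = e' (xs ! i)"
proof
  let ?p = "\<lambda>i. xs ! i"
  let ?e = "\<lambda>j. e (the_inv_into {..<N} ?p j)"
  have b: "bij_betw ?p {..<N} {..<N}" by (rule bij_betw_perm_nth[OF assms])
  then have inj: "inj_on ?p {..<N}" by (simp add: bij_betw_def)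
  show *: "e i = ?e (xs ! i)" if "i < N" for i
    using the_inv_into_f_f[OF inj, of i] that by simp
  show "(\<Prod>i<N. x (xs ! i) ^ e i) = (\<Prod>i<N. x i ^ ?e i)" for x :: "nat \<Rightarrow> complex"
    by (subst prod.reindex_bij_betw[OF b, symmetric], intro prod.cong) (use * in auto)
  show "(\<Sum>i<N. e i) = (\<Sum>i<N. ?e i)"
    by (subst sum.reindex_bij_betw[OF b, symmetric], intro sum.cong) (use * in auto)
qed

lemma homog_perm:
  assumes "homog N D f" "xs \<in> permutations_of_set {..<N}"
  shows "homog N D (\<lambda>x. f (\<lambda>i. x (xs ! i)))"
  using assms(1)
proof (induction rule: homog.induct)
  case (homog_monom e)
  from monom_perm[OF assms(2), of e] obtain e' where e':
    "\<And>x::nat \<Rightarrow> complex. (\<Prod>i<N. x (xs ! i) ^ e i) = (\<Prod>i<N. x i ^ e' i)" 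
    "(\<Sum>i<N. e i) = (\<Sum>i<N. e' i)" by metis
  show ?case unfolding e' by (rule homog.homog_monom)
next
  case (homog_add D f g)
  then show ?case by (intro homog.homog_add)
next
  case (homog_cmult D f c)
  then show ?case by (intro homog.homog_cmult)
qed

section \<open>Averages over the torus of unimodular coordinates with product 1\<close>

abbreviation angle_measure :: "nat \<Rightarrow> (nat \<Rightarrow> real) measure" where
  "angle_measure N \<equiv> \<Pi>\<^sub>M i\<in>{..<N - 1}. restrict_space lborel {0..2 * pi}"

definition su_avg :: "nat \<Rightarrow> ((nat \<Rightarrow> complex) \<Rightarrow> complex) \<Rightarrow> complex" where
  "su_avg N f = complex_of_real (1 / (2 * pi)) ^ (N - 1) *
     integral\<^sup>L (angle_measure N) (\<lambda>\<theta>. f (torus_pt N \<theta>))"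

text \<open>Pointwise identities and bounds use only these two properties of torus points; both
  survive a permutation of the coordinates.\<close>

definition on_su :: "nat \<Rightarrow> (nat \<Rightarrow> complex) \<Rightarrow> bool" where
  "on_su N x \<longleftrightarrow> (\<forall>i<N. norm (x i) = 1) \<and> (\<Prod>i<N. x i) = 1"

lemma on_su_torus_pt:
  assumes "N \<ge> 1"
  shows "on_su N (torus_pt N \<theta>)"
proof -
  obtain n where N: "N = Suc n" using assms by (cases N) auto
  have "norm (torus_pt N \<theta> i) = 1" for i
    by (simp add: torus_pt_def norm_inverse prod_norm[symmetric])
  moreover have "(\<Prod>i<N. torus_pt N \<theta> i) = 1"
  proof -
    have "(\<Prod>i<N. torus_pt N \<theta> i) = (\<Prod>i<n. cis (\<theta> i)) * inverse (\<Prod>i<n. cis (\<theta> i))"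
      by (simp add: N torus_pt_def)
    then show ?thesis by simp
  qed
  ultimately show ?thesis by (simp add: on_su_def)
qed

lemma su_avg_cong:
  assumes "N \<ge> 1" "\<And>x. on_su N x \<Longrightarrow> f x = g x"
  shows "su_avg N f = su_avg N g"
  unfolding su_avg_def using assms(2)[OF on_su_torus_pt[OF assms(1)]] by simp

lemma integrable_cis: "integrable (restrict_space lborel {0..2 * pi}) (\<lambda>t. cis (of_int n * t))"
  and integral_cis: "integral\<^sup>L (restrict_space lborel {0..2 * pi}) (\<lambda>t. cis (of_int n * t)) =
    (if n = 0 then 2 * pi else 0)"
proof -
  have cont: "continuous_on {0..2 * pi} (\<lambda>t. cis (of_int n * t))"
    by (intro continuous_intros)
  have si: "set_integrable lborel {0..2 * pi} (\<lambda>t. cis (of_int n * t))"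
    by (rule borel_integrable_atLeastAtMost') (rule cont)
  then show "integrable (restrict_space lborel {0..2 * pi}) (\<lambda>t. cis (of_int n * t))"
    by (simp add: integrable_restrict_space set_integrable_def)
  have "integral\<^sup>L (restrict_space lborel {0..2 * pi}) (\<lambda>t. cis (of_int n * t)) =
      (LINT t:{0..2*pi}|lborel. cis (of_int n * t))"
    by (simp add: integral_restrict_space set_lebesgue_integral_def)
  also have "\<dots> = integral {0..2*pi} (\<lambda>t. cis (of_int n * t))"
    by (rule set_borel_integral_eq_integral(2)[OF si])
  also have "\<dots> = (if n = 0 then 2 * pi else 0)"
  proof (cases "n = 0")
    case True
    then show ?thesis by (simp add: scaleR_conv_of_real)
  next
    case False
    have "((\<lambda>t. cis (of_int n * t)) has_integral
       (cis (of_int n * (2*pi)) / (\<i> * of_int n) - cis (of_int n * 0) / (\<i> * of_int n))) {0..2*pi}"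
    proof (rule fundamental_theorem_of_calculus)
      fix t assume "t \<in> {0..2*pi}"
      show "((\<lambda>t. cis (of_int n * t) / (\<i> * of_int n)) has_vector_derivative cis (of_int n * t))
            (at t within {0..2*pi})"
      proof -
        have "((\<lambda>z. exp (\<i> * of_int n * z) / (\<i> * of_int n)) has_field_derivative
            exp (\<i> * of_int n * of_real t)) (at (of_real t))"
          using False by (auto intro!: derivative_eq_intros)
        from has_vector_derivative_real_field[OF this, of "{0..2*pi}"] show ?thesis
          by (simp add: cis_conv_exp mult.assoc)
      qed
    qed auto
    moreover have "cis (of_int n * (2*pi)) = 1"
      using cis_multiple_2pi[of "of_int n"] by (simp add: mult.commute)
    ultimately show ?thesis using False by (simp add: integral_unique)
  qed
  finally show "integral\<^sup>L (restrict_space lborel {0..2 * pi}) (\<lambda>t. cis (of_int n * t)) =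
    (if n = 0 then 2 * pi else 0)" .
qed

lemma finite_measure_arc: "finite_measure (restrict_space lborel {0..2 * pi})"
  by (rule finite_measureI) (simp add: space_restrict_space emeasure_restrict_space emeasure_lborel_Icc_eq)

lemma sigma_finite_arc: "product_sigma_finite (\<lambda>i::nat. restrict_space lborel {0..2 * pi})"
proof
  fix i :: nat
  show "\<exists>A. countable A \<and> A \<subseteq> sets (restrict_space lborel {0..2 * pi}) \<and>
         \<Union> A = space (restrict_space lborel {0..2 * pi}) \<and>
         (\<forall>a\<in>A. emeasure (restrict_space lborel {0..2 * pi}) a \<noteq> \<infinity>)"
    using sigma_finite_measure.sigma_finite_countable finite_measure_arc finite_measure_def by blast
qed

text \<open>Eliminating the last coordinate through the product relation leaves only exponent
  differences, so the integral factors over the angles.\<close>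

lemma monom_torus_pt:
  assumes "N \<ge> 1"
  shows "(\<Prod>i<N. torus_pt N \<theta> i ^ e i) = (\<Prod>i<N - 1. cis (of_int (int (e i) - int (e (N - 1))) * \<theta> i))"
proof -
  obtain n where N: "N = Suc n" using assms by (cases N) auto
  have "(\<Prod>i<N. torus_pt N \<theta> i ^ e i) = (\<Prod>i<n. cis (\<theta> i) ^ e i) * inverse (\<Prod>i<n. cis (\<theta> i)) ^ e n"
    by (simp add: N torus_pt_def)
  also have "\<dots> = (\<Prod>i<n. cis (\<theta> i) ^ e i * inverse (cis (\<theta> i)) ^ e n)"
    by (simp only: prod.distrib prod_power_distrib flip: prod_inversef[unfolded o_def])
  also have "\<dots> = (\<Prod>i<n. cis (of_int (int (e i) - int (e n)) * \<theta> i))"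
    by (intro prod.cong) (simp_all add: Complex.DeMoivre cis_mult algebra_simps)
  finally show ?thesis by (simp add: N)
qed

lemma integrable_monom:
  assumes "N \<ge> 1"
  shows "integrable (angle_measure N) (\<lambda>\<theta>. \<Prod>i<N. torus_pt N \<theta> i ^ e i)"
  unfolding monom_torus_pt[OF assms]
  by (rule product_sigma_finite.product_integrable_prod[OF sigma_finite_arc]) (auto intro: integrable_cis simp del: of_int_diff)

text \<open>By orthogonality of characters a monomial survives only if all exponents agree; it is
  then a power of the product of the coordinates, hence 1 on the torus.\<close>

lemma su_avg_monom:
  assumes "N \<ge> 1"
  shows "su_avg N (\<lambda>x. \<Prod>i<N. x i ^ e i) = (if \<forall>i<N. e i = e (N - 1) then 1 else 0)"
proof -
  have "su_avg N (\<lambda>x. \<Prod>i<N. x i ^ e i) = complex_of_real (1 / (2 * pi)) ^ (N - 1) *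
      (\<Prod>i<N - 1. if int (e i) - int (e (N - 1)) = 0 then 2 * pi else 0)"
    unfolding su_avg_def monom_torus_pt[OF assms]
    by (subst product_sigma_finite.product_integral_prod[OF sigma_finite_arc], simp, rule integrable_cis)
       (simp add: integral_cis if_distrib cong: if_cong del: of_int_diff)
  also have "\<dots> = (\<Prod>i<N - 1. if e i = e (N - 1) then 1 else 0)"
  proof -
    have "complex_of_real (1 / (2 * pi)) ^ (N - 1) = (\<Prod>i<N - 1. complex_of_real (1 / (2 * pi)))"
      by simp
    then show ?thesis
      by (simp only: of_real_prod flip: prod.distrib, intro prod.cong) auto
  qed
  also have "\<dots> = (if \<forall>i<N. e i = e (N - 1) then 1 else 0)"
  proof (cases "\<forall>i<N. e i = e (N - 1)")
    case True
    then have "e i = e (N - 1)" if "i < N - 1" for i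
      using that by (metis diff_le_self order_less_le_trans)
    then have "(\<Prod>i<N - 1. if e i = e (N - 1) then 1 else 0) = (\<Prod>i<N - 1. 1 :: complex)"
      by (intro prod.cong refl if_P) (simp only: lessThan_iff)
    then show ?thesis by (simp only: if_P[OF True] prod.neutral_const)
  next
    case False
    then obtain i where i: "i < N" "e i \<noteq> e (N - 1)" by blast
    then have "i \<in> {..<N - 1}" by (cases "i = N - 1") auto
    then have "(\<Prod>i<N - 1. if e i = e (N - 1) then 1 else 0 :: complex) = 0"
      using i(2) by (intro prod_zero) auto
    then show ?thesis by (simp only: if_not_P[OF False])
  qed
  finally show ?thesis .
qed

lemma integrable_homog:
  assumes "homog N D f" "N \<ge> 1"
  shows "integrable (angle_measure N) (\<lambda>\<theta>. f (torus_pt N \<theta>))"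
  using assms(1)
proof (induction rule: homog.induct)
  case (homog_monom e)
  show ?case by (rule integrable_monom[OF assms(2)])
next
  case (homog_add D f g)
  show ?case by (rule Bochner_Integration.integrable_add[OF homog_add.IH])
next
  case (homog_cmult D f c)
  show ?case by (rule integrable_mult_right[OF homog_cmult.IH])
qed

lemma su_avg_add:
  assumes "homog N D f" "homog N D g" "N \<ge> 1"
  shows "su_avg N (\<lambda>x. f x + g x) = su_avg N f + su_avg N g"
  unfolding su_avg_def
  using integrable_homog[OF assms(1,3)] integrable_homog[OF assms(2,3)] by (simp add: distrib_left)

lemma su_avg_cmult: "su_avg N (\<lambda>x. c * f x) = c * su_avg N f"
  unfolding su_avg_def by simp

lemma su_avg_zero_degree:
  assumes "homog N D f" "\<not> N dvd D" "N \<ge> 1"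
  shows "su_avg N f = 0"
  using assms(1,2)
proof (induction rule: homog.induct)
  case (homog_monom e)
  have "\<not> (\<forall>i<N. e i = e (N - 1))"
  proof
    assume "\<forall>i<N. e i = e (N - 1)"
    then have "(\<Sum>i<N. e i) = (\<Sum>i<N. e (N - 1))" by (intro sum.cong refl) blast
    then show False using homog_monom by auto
  qed
  then show ?case by (simp only: su_avg_monom[OF assms(3)] if_False)
next
  case (homog_add D f g)
  then show ?case by (simp add: su_avg_add[OF _ _ assms(3)])
next
  case (homog_cmult D f c)
  then show ?case by (simp add: su_avg_cmult)
qed

text \<open>In degree \<open>N * d\<close> only the d-th power of the product of all variables
  survives, and it contains \<open>x i\<close> to the power d. This algebraic rule replaces a
  contour shift: the scaled point may leave the torus.\<close>

lemma su_avg_scale: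
  assumes "homog N (N * d) f" "i < N" 
  shows "su_avg N (\<lambda>x. f (x(i := c * x i))) = c ^ d * su_avg N f"
proof -
  have "su_avg N (\<lambda>x. f (x(i := c * x i))) = c ^ d * su_avg N f" if "homog N D f" "D = N * d" for D
    using that
  proof (induction rule: homog.induct)
    case (homog_monom e)
    have "(\<Prod>j<N. (x(i := c * x i)) j ^ e j) = c ^ e i * (\<Prod>j<N. x j ^ e j)" for x
    proof -
      have "(\<Prod>j<N. (x(i := c * x i)) j ^ e j) = (\<Prod>j<N. if j = i then c ^ e i else 1) * (\<Prod>j<N. x j ^ e j)"
        by (subst prod.distrib[symmetric], intro prod.cong) (auto simp: power_mult_distrib)
      then show ?thesis using assms(2) by simp
    qed
    then have "su_avg N (\<lambda>x. \<Prod>j<N. (x(i := c * x i)) j ^ e j) =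
        su_avg N (\<lambda>x. c ^ e i * (\<Prod>j<N. x j ^ e j))"
      by (intro arg_cong[where f = "su_avg N"] ext)
    then have "su_avg N (\<lambda>x. \<Prod>j<N. (x(i := c * x i)) j ^ e j) = c ^ e i * su_avg N (\<lambda>x. \<Prod>j<N. x j ^ e j)"
      unfolding su_avg_cmult .
    also have "\<dots> = c ^ d * su_avg N (\<lambda>x. \<Prod>j<N. x j ^ e j)"
    proof (cases "\<forall>i<N. e i = e (N - 1)")
      case True
      then have "(\<Sum>i<N. e i) = (\<Sum>i<N. e (N - 1))" by (intro sum.cong refl) blast
      also have "\<dots> = N * e (N - 1)" by simp
      finally have "N * e (N - 1) = N * d" unfolding homog_monom by (rule sym)
      then have "e (N - 1) = d" using assms(2) by simp
      moreover have "e i = e (N - 1)" using True assms(2) by blast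
      ultimately show ?thesis by (simp only:)
    next
      case False
      have "su_avg N (\<lambda>x. \<Prod>j<N. x j ^ e j) = 0"
        using assms(2) su_avg_monom[of N e] unfolding if_not_P[OF False] by linarith
      then show ?thesis by simp
    qed
    finally show ?case .
  next
    case (homog_add D f g)
    have "N \<ge> 1" using assms(2) by simp
    note add = su_avg_add[OF homog_scale[OF homog_add.hyps(1)] homog_scale[OF homog_add.hyps(2)] this]
      su_avg_add[OF homog_add.hyps this]
    show ?case unfolding add homog_add.IH[OF homog_add.prems] distrib_left ..
  next
    case (homog_cmult D f c)
    then show ?case by (simp add: su_avg_cmult)
  qed
  then show ?thesis using assms(1) by blast
qed

lemma su_avg_perm:
  assumes "homog N D f" "N \<ge> 1" "xs \<in> permutations_of_set {..<N}"
  shows "su_avg N (\<lambda>x. f (\<lambda>i. x (xs ! i))) = su_avg N f"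
  using assms(1)
proof (induction rule: homog.induct)
  case (homog_monom e)
  from monom_perm[OF assms(3), of e] obtain e' where e':
    "\<And>x::nat \<Rightarrow> complex. (\<Prod>i<N. x (xs ! i) ^ e i) = (\<Prod>i<N. x i ^ e' i)" 
    "(\<Sum>i<N. e i) = (\<Sum>i<N. e' i)" "\<And>i. i < N \<Longrightarrow> e i = e' (xs ! i)" by metis
  have im: "(\<lambda>i. xs ! i) ` {..<N} = {..<N}"
    using bij_betw_perm_nth[OF assms(3)] by (simp add: bij_betw_def)
  \<comment> \<open>Constancy is restated without the distinguished index \<open>N - 1\<close>,
    which a permutation may move.\<close>
  have const_iff: "(\<forall>i<N. u i = u (N - 1)) \<longleftrightarrow> (\<exists>k. \<forall>i\<in>{..<N}. u i = k)" for u :: "nat \<Rightarrow> nat"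
  proof
    assume "\<forall>i<N. u i = u (N - 1)"
    then show "\<exists>k. \<forall>i\<in>{..<N}. u i = k" by blast
  next
    assume "\<exists>k. \<forall>i\<in>{..<N}. u i = k"
    then show "\<forall>i<N. u i = u (N - 1)" using assms(2) by fastforce
  qed
  have "(\<forall>i<N. e i = e (N - 1)) \<longleftrightarrow> (\<exists>k. \<forall>i\<in>{..<N}. e' (xs ! i) = k)"
    unfolding const_iff using e'(3) by simp
  also have "\<dots> \<longleftrightarrow> (\<exists>k. \<forall>i\<in>(\<lambda>i. xs ! i) ` {..<N}. e' i = k)" by simp
  also have "\<dots> \<longleftrightarrow> (\<forall>i<N. e' i = e' (N - 1))"
    unfolding im const_iff by simp
  finally show ?case unfolding e'(1) su_avg_monom[OF assms(2)] by simp
next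
  case (homog_add D f g)
  then show ?case
    using su_avg_add[OF homog_add(1,2) assms(2)]
      su_avg_add[OF homog_perm[OF homog_add(1) assms(3)] homog_perm[OF homog_add(2) assms(3)] assms(2)]
    by simp
next
  case (homog_cmult D f c)
  then show ?case by (simp add: su_avg_cmult)
qed

lemma integrable_const_angle_measure: "integrable (angle_measure N) (\<lambda>_. c::real)"
proof -
  have "integrable (restrict_space lborel {0..2 * pi}) (\<lambda>_. 1 :: real)"
    by (rule finite_measure.integrable_const[OF finite_measure_arc])
  then have "integrable (angle_measure N) (\<lambda>\<theta>. \<Prod>i<N - 1. (1::real))"
    by (intro product_sigma_finite.product_integrable_prod[OF sigma_finite_arc, of _ "\<lambda>_ _. 1"]) auto
  then have "integrable (angle_measure N) (\<lambda>\<theta>. c * 1)"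
    by (intro integrable_mult_right) simp
  then show ?thesis by simp
qed

text \<open>Dominated convergence on a space of finite measure. It carries exact identities for
  polynomials over to infinite products, and yields the integrability needed to exchange sums and
  integrals.\<close>

lemma su_avg_limit:
  fixes h :: "nat \<Rightarrow> (nat \<Rightarrow> complex) \<Rightarrow> complex"
  assumes N: "N \<ge> 1" and h: "\<And>n. homog N (D n) (h n)"
    and bd: "\<And>n x. on_su N x \<Longrightarrow> norm (h n x) \<le> B"
    and lim: "\<And>x. on_su N x \<Longrightarrow> (\<lambda>n. h n x) \<longlonglongrightarrow> f x"
  shows "(\<lambda>n. su_avg N (h n)) \<longlonglongrightarrow> su_avg N f"
    and "integrable (angle_measure N) (\<lambda>\<theta>. f (torus_pt N \<theta>))"
proof -
  have m: "(\<lambda>\<theta>. h n (torus_pt N \<theta>)) \<in> borel_measurable (angle_measure N)" for n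
    using integrable_homog[OF h N] by (rule borel_measurable_integrable)
  have l: "(\<lambda>n. h n (torus_pt N \<theta>)) \<longlonglongrightarrow> f (torus_pt N \<theta>)" for \<theta>
    by (rule lim[OF on_su_torus_pt[OF N]])
  have mf: "(\<lambda>\<theta>. f (torus_pt N \<theta>)) \<in> borel_measurable (angle_measure N)"
    by (rule borel_measurable_LIMSEQ_metric[OF m l])
  have b: "norm (h n (torus_pt N \<theta>)) \<le> B" for n \<theta>
    by (rule bd[OF on_su_torus_pt[OF N]])
  show "integrable (angle_measure N) (\<lambda>\<theta>. f (torus_pt N \<theta>))"
    by (rule integrable_dominated_convergence[where s = "\<lambda>n \<theta>. h n (torus_pt N \<theta>)",
        OF mf m integrable_const_angle_measure[of N B]]) (intro AE_I2 l b)+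
  have "(\<lambda>n. integral\<^sup>L (angle_measure N) (\<lambda>\<theta>. h n (torus_pt N \<theta>))) \<longlonglongrightarrow>
      integral\<^sup>L (angle_measure N) (\<lambda>\<theta>. f (torus_pt N \<theta>))"
    by (rule integral_dominated_convergence[where s = "\<lambda>n \<theta>. h n (torus_pt N \<theta>)",
        OF mf m integrable_const_angle_measure[of N B]]) (intro AE_I2 l b)+
  then show "(\<lambda>n. su_avg N (h n)) \<longlonglongrightarrow> su_avg N f"
    unfolding su_avg_def by (intro tendsto_mult tendsto_const)
qed

section \<open>Evaluation on a grid\<close>

text \<open>\<open>P\<close> is the Lagrange interpolant of z^e at the d + 1 nodes, hence equals
  z^e. The polynomials \<open>L c\<close> are monic of degree d, so comparing coefficients of z^d
  gives the sum.\<close>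

lemma divided_difference_power:
  fixes C :: "'a::field set"
  assumes C: "card C = Suc d" and e: "e \<le> d"
  shows "(\<Sum>c\<in>C. c ^ e / (\<Prod>b\<in>C - {c}. c - b)) = (if e = d then 1 else 0)"
proof -
  have fin: "finite C" using C by (metis card.infinite nat.simps(3))
  define L where "L c = (\<Prod>b\<in>C - {c}. [:- b, 1:])" for c
  define w where "w c = c ^ e / (\<Prod>b\<in>C - {c}. c - b)" for c
  define P where "P = (\<Sum>c\<in>C. smult (w c) (L c))"
  have degL: "degree (L c) = d" if "c \<in> C" for c
    unfolding L_def using C fin that by (subst degree_prod_eq_sum_degree) auto
  have monicL: "coeff (L c) d = 1" if "c \<in> C" for c
    using lead_coeff_prod[of "\<lambda>b. [:- b, 1:]" "C - {c}"] degL[OF that] by (simp add: L_def)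
  have "poly P z = poly (monom 1 e) z" if z: "z \<in> C" for z
  proof -
    have "poly P z = (\<Sum>c\<in>C. w c * (\<Prod>b\<in>C - {c}. z - b))"
      by (simp add: P_def L_def poly_sum poly_prod)
    also have "\<dots> = (\<Sum>c\<in>C. if c = z then z ^ e else 0)"
    proof (intro sum.cong refl)
      fix c assume c: "c \<in> C"
      show "w c * (\<Prod>b\<in>C - {c}. z - b) = (if c = z then z ^ e else 0)"
      proof (cases "c = z")
        case True
        have "(\<Prod>b\<in>C - {z}. z - b) \<noteq> 0" using fin by simp
        then show ?thesis using True by (simp add: w_def)
      next
        case False
        then have "(\<Prod>b\<in>C - {c}. z - b) = 0"
          using fin z by (intro prod_zero) auto
        with False show ?thesis by simp
      qed
    qed
    also have "\<dots> = z ^ e" using fin z by simp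
    finally show ?thesis by (simp add: poly_monom)
  qed
  moreover have "degree P \<le> d"
    unfolding P_def by (intro degree_sum_le fin order.trans[OF degree_smult_le]) (simp add: degL)
  moreover have "degree (monom (1::'a) e) \<le> d"
    using e degree_monom_le[of "1::'a" e] by linarith
  ultimately have "P = monom 1 e"
    using C by (intro poly_eqI_degree[of C]) auto
  then have "coeff P d = (if e = d then 1 else 0)" by simp
  moreover have "coeff P d = (\<Sum>c\<in>C. w c)"
    unfolding P_def coeff_sum by (intro sum.cong) (auto simp: monicL)
  ultimately show ?thesis by (simp add: w_def)
qed

text \<open>An iterated divided difference. With d + 1 nodes and total degree N d it reads off the
  coefficient of the monomial with all exponents d, as in the quantitative Combinatorial
  Nullstellensatz.\<close>

definition grid_sum :: "nat \<Rightarrow> complex set \<Rightarrow> ((nat \<Rightarrow> complex) \<Rightarrow> complex) \<Rightarrow> complex" where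
  "grid_sum N C f =
     (\<Sum>c\<in>PiE {..<N} (\<lambda>_. C). f c / (\<Prod>i<N. \<Prod>b\<in>C - {c i}. c i - b))"

lemma su_avg_eq_grid_sum:
  assumes f: "homog N (N * d) f" and C: "card C = Suc d" and N: "N \<ge> 1"
  shows "su_avg N f = grid_sum N C f"
proof -
  have fin: "finite C" using C by (metis card.infinite nat.simps(3))
  have "su_avg N f = grid_sum N C f" if "homog N D f" "D = N * d" for D
    using that
  proof (induction rule: homog.induct)
    case (homog_monom e)
    have "grid_sum N C (\<lambda>x. \<Prod>i<N. x i ^ e i) =
        (\<Sum>c\<in>PiE {..<N} (\<lambda>_. C). \<Prod>i<N. c i ^ e i / (\<Prod>b\<in>C - {c i}. c i - b))"
      by (simp add: grid_sum_def prod_dividef)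
    also have "\<dots> = (\<Prod>i<N. \<Sum>c\<in>C. c ^ e i / (\<Prod>b\<in>C - {c}. c - b))"
      by (rule prod_sum_PiE[symmetric]) (auto simp: fin)
    also have "\<dots> = su_avg N (\<lambda>x. \<Prod>i<N. x i ^ e i)"
    proof (cases "\<forall>i<N. e i = e (N - 1)")
      case True
      then have "(\<Sum>i<N. e i) = (\<Sum>i<N. e (N - 1))" by (intro sum.cong refl) blast
      also have "\<dots> = N * e (N - 1)" by simp
      finally have "N * e (N - 1) = N * d" unfolding homog_monom by (rule sym)
      then have ed: "e (N - 1) = d" using N by simp
      have "(\<Sum>c\<in>C. c ^ e i / (\<Prod>b\<in>C - {c}. c - b)) = 1" if "i < N" for i
      proof -
        have "e i = e (N - 1)" using True that by blast
        then have "e i = d" unfolding ed .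
        then show ?thesis using divided_difference_power[OF C, of d] by simp
      qed
      then have "(\<Prod>i<N. \<Sum>c\<in>C. c ^ e i / (\<Prod>b\<in>C - {c}. c - b)) = 1"
        by (intro prod.neutral) simp
      then show ?thesis unfolding su_avg_monom[OF N] if_P[OF True] .
    next
      case False
      \<comment> \<open>The exponents average to d, so if they are not all equal one is below d. Its
        divided difference vanishes, whatever the factors with exponents above d are.\<close>
      have "\<exists>i<N. e i < d"
      proof (rule ccontr)
        assume *: "\<not> (\<exists>i<N. e i < d)"
        have "(\<Sum>i<N. e i - d) = (\<Sum>i<N. e i) - (\<Sum>i<N. d)"
          by (rule sum_subtractf_nat) (use * in auto)
        also have "\<dots> = 0" using homog_monom by simp
        finally have "\<forall>i<N. e i - d = 0" by simp
        with * have "\<forall>i<N. e i = d" by (metis diff_is_0_eq le_antisym not_less)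
        moreover have "N - 1 < N" using N by simp
        ultimately have "\<forall>i<N. e i = e (N - 1)" by metis
        with False show False ..
      qed
      then obtain i where i: "i < N" "e i < d" by blast
      then have "(\<Sum>c\<in>C. c ^ e i / (\<Prod>b\<in>C - {c}. c - b)) = 0"
        using divided_difference_power[OF C, of "e i"] by simp
      then have "(\<Prod>i<N. \<Sum>c\<in>C. c ^ e i / (\<Prod>b\<in>C - {c}. c - b)) = 0"
        using i(1) by (intro prod_zero) auto
      then show ?thesis unfolding su_avg_monom[OF N] if_not_P[OF False] .
    qed
    finally show ?case ..
  next
    case (homog_add D f g)
    have "grid_sum N C (\<lambda>x. f x + g x) = grid_sum N C f + grid_sum N C g"
      by (simp add: grid_sum_def add_divide_distrib sum.distrib)
    then show ?case
      unfolding su_avg_add[OF homog_add.hyps N] homog_add.IH[OF homog_add.prems] by (rule sym)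
  next
    case (homog_cmult D f c)
    have "grid_sum N C (\<lambda>x. c * f x) = c * grid_sum N C f"
      by (simp add: grid_sum_def sum_distrib_left)
    then show ?case unfolding su_avg_cmult homog_cmult.IH[OF homog_cmult.prems] by (rule sym)
  qed
  then show ?thesis using f by blast
qed

text \<open>The values are pairwise at least \<open>a\<close> apart and lie in an interval of length
  \<open>(card S - 1) * a\<close>, so their sorted gaps are exactly \<open>a\<close>. A descent in
  index order would cost \<open>a + 1\<close>, so the values increase with the index.\<close>

lemma spaced_unique:
  fixes \<alpha> :: "nat \<Rightarrow> nat"
  assumes a: "a \<ge> 1" and "finite S" "S \<noteq> {}"
    and gap: "\<And>i j. i \<in> S \<Longrightarrow> j \<in> S \<Longrightarrow> i < j \<Longrightarrow> \<alpha> j \<ge> \<alpha> i + a \<or> \<alpha> i \<ge> \<alpha> j + a + 1"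
    and bd: "\<And>i. i \<in> S \<Longrightarrow> \<alpha> i \<le> (card S - 1) * a"
    and "i \<in> S"
  shows "\<alpha> i = a * card {j \<in> S. j < i}"
  using assms(2-)
proof (induction "card S" arbitrary: S i)
  case 0
  then show ?case by simp
next
  case (Suc k)
  show ?case
  proof (cases "k = 0")
    case True
    with Suc obtain s where S: "S = {s}" by (metis One_nat_def card_1_singletonE)
    then have "{j \<in> S. j < i} = {}" using Suc.prems by auto
    then show ?thesis using Suc.prems S by simp
  next
    case False
    obtain M where "M \<in> S" "Max (\<alpha> ` S) = \<alpha> M"
      using obtains_MAX[OF Suc.prems(1,2), of \<alpha>] by metis
    then have M: "M \<in> S" "\<And>j. j \<in> S \<Longrightarrow> \<alpha> j \<le> \<alpha> M"
      using Suc.prems(1) by (auto simp flip: \<open>Max (\<alpha> ` S) = \<alpha> M\<close>)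
    let ?T = "S - {M}"
    have cT: "card ?T = k" using Suc.hyps(2) M Suc.prems by simp
    then have "card ?T > 0" using False by simp
    then have T: "finite ?T" "?T \<noteq> {}" unfolding card_gt_0_iff by blast+
    \<comment> \<open>Since \<open>M\<close> has the largest value, the spacing condition puts every
      other value at least \<open>a\<close> below it.\<close>
    have dist: "\<alpha> M \<ge> \<alpha> j + a" if "j \<in> ?T" for j
      using Suc.prems(3)[of j M] Suc.prems(3)[of M j] M that by (cases j M rule: linorder_cases) force+
    have bM: "\<alpha> M \<le> k * a" using Suc.prems(4)[OF M(1)] Suc.hyps(2)[symmetric] by simp
    have IH: "\<alpha> j = a * card {l \<in> ?T. l < j}" if "j \<in> ?T" for j
    proof (rule Suc.hyps(1)[OF cT[symmetric] T _ _ that])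
      fix i j assume "i \<in> ?T" "j \<in> ?T" "i < j"
      then show "\<alpha> i + a \<le> \<alpha> j \<or> \<alpha> j + a + 1 \<le> \<alpha> i" using Suc.prems(3) by auto
    next
      fix i assume "i \<in> ?T"
      then have "\<alpha> i + a \<le> k * a" using dist bM by force
      then show "\<alpha> i \<le> (card ?T - 1) * a" using False unfolding cT by (cases k) auto
    qed
    \<comment> \<open>The largest remaining index \<open>m\<close> already has the value (k - 1) a,
      so the gap up to \<open>M\<close> is exactly \<open>a\<close>. If \<open>M\<close> were the
      smaller index, a gap of \<open>a + 1\<close> would be required.\<close>
    define m where "m = Max ?T"
    have m: "m \<in> ?T" "\<And>j. j \<in> ?T \<Longrightarrow> j \<le> m" using Max_in[OF T] Max_ge[OF T(1)] unfolding m_def by blast+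
    have "{l \<in> ?T. l < m} = ?T - {m}" using m by (auto simp: order.strict_iff_order)
    then have "\<alpha> m = a * (k - 1)" using IH[OF m(1)] m(1) T(1) cT by simp
    then have am: "\<alpha> m + a = k * a" using False by (cases k) auto
    have "m < M"
    proof (rule ccontr)
      assume "\<not> m < M"
      then have "M < m" using m(1) by auto
      then have "\<alpha> m \<ge> \<alpha> M + a \<or> \<alpha> M \<ge> \<alpha> m + a + 1"
        using Suc.prems(3)[of M m] M(1) m(1) by blast
      then show False using am bM dist[OF m(1)] a by linarith
    qed
    then have less: "j < M" if "j \<in> ?T" for j using m(2)[OF that] by simp
    show ?thesis
    proof (cases "i = M")
      case True
      have "{j \<in> S. j < M} = ?T" using less by auto
      moreover have "\<alpha> M = k * a" using bM dist[OF m(1)] am by simp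
      ultimately show ?thesis using True cT by simp
    next
      case False
      then have "{j \<in> S. j < i} = {j \<in> ?T. j < i}" using less[of i] Suc.prems(5) by auto
      then show ?thesis using IH[of i] Suc.prems(5) False by simp
    qed
  qed
qed

section \<open>The equal-parameter q-Dyson identity\<close>

definition qpoch :: "complex \<Rightarrow> complex \<Rightarrow> nat \<Rightarrow> complex" where
  "qpoch u q n = (\<Prod>k<n. 1 - u * q ^ k)"

text \<open>The product of \<open>(x i / x j; q)_a (q x j / x i; q)_a\<close> over i < j, with
  denominators cleared by the a-th powers of \<open>x i\<close> and \<open>x j\<close> so that it
  becomes a homogeneous polynomial.\<close>

definition dyson :: "nat \<Rightarrow> nat \<Rightarrow> complex \<Rightarrow> (nat \<Rightarrow> complex) \<Rightarrow> complex" where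
  "dyson N a q x = (\<Prod>i<N. \<Prod>j\<in>{i<..<N}.
     (\<Prod>t<a. x j - x i * q ^ t) * (\<Prod>t<a. x i - x j * q ^ Suc t))"

text \<open>There are N (N - 1) / 2 pairs with 2 a linear factors each; the total is written as N d
  to fit \<open>su_avg_eq_grid_sum\<close> and \<open>su_avg_scale\<close>.\<close>

lemma homog_dyson: "homog N (N * ((N - 1) * a)) (dyson N a q)"
proof -
  have "homog N (\<Sum>i<N. \<Sum>j\<in>{i<..<N}. (\<Sum>t<a. 1) + (\<Sum>t<a. 1)) (dyson N a q)"
    unfolding dyson_def [abs_def]
    by (intro homog_prod homog_mult homog_linear) auto
  moreover have "(\<Sum>i<N. \<Sum>j\<in>{i<..<N}. (\<Sum>t<a. 1) + (\<Sum>t<a. 1)) = N * ((N - 1) * a)"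
  proof -
    have "(\<Sum>i<N. \<Sum>j\<in>{i<..<N}. (\<Sum>t<a. 1) + (\<Sum>t<a. 1 :: nat)) = (\<Sum>i<N. (N - Suc i) * (2 * a))"
      by (simp add: mult_2)
    also have "\<dots> = (\<Sum>i<N. i * (2 * a))" by (rule sum.nat_diff_reindex)
    also have "\<dots> = N * ((N - 1) * a)"
    proof (induction N)
      case (Suc N)
      then show ?case by (cases N) (simp_all add: algebra_simps)
    qed simp
    finally show ?thesis .
  qed
  ultimately show ?thesis by simp
qed

section \<open>Finite products of powers of q\<close>

lemma prod_lessThan_add: "(\<Prod>s<m + n. f s) = (\<Prod>s<m. f s) * (\<Prod>s<n. f (m + s :: nat) :: 'a::comm_monoid_mult)"
  by (induction n) (simp_all add: mult.assoc)

lemma prod_blocks: "(\<Prod>i<n. \<Prod>t<a. f (i * a + t :: nat) :: 'a::comm_monoid_mult) = (\<Prod>s<n * a. f s)"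
  by (induction n) (simp_all add: prod_lessThan_add add.commute[of a])

lemma power_neq_one:
  fixes q :: complex
  assumes "norm q < 1" "k > 0"
  shows "q ^ k \<noteq> 1"
proof
  assume "q ^ k = 1"
  then have "norm q ^ k = 1" by (metis norm_one norm_power)
  moreover have "norm q ^ k < 1" using assms by (intro power_less_one_iff[THEN iffD2]) auto
  ultimately show False by simp
qed

lemma qpoch_nonzero:
  assumes "norm q < 1"
  shows "qpoch q q n \<noteq> 0"
proof -
  have "1 - q * q ^ k \<noteq> 0" for k
    using power_neq_one[OF assms, of "Suc k"] by simp
  then show ?thesis by (simp add: qpoch_def)
qed

lemma power_inj:
  fixes q :: complex
  assumes "norm q < 1" "q \<noteq> 0" "q ^ s = q ^ t"
  shows "s = t"
proof -
  have "\<not> s < t" if "q ^ s = q ^ t" for s t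
  proof
    assume "s < t"
    then have "q ^ s * q ^ (t - s) = q ^ t" by (simp flip: power_add)
    then have "q ^ s * q ^ (t - s) = q ^ s * 1" using that by simp
    then show False using power_neq_one[OF assms(1), of "t - s"] \<open>s < t\<close> assms(2) by simp
  qed
  from this[of s t] this[of t s] assms(3) show ?thesis by simp
qed

text \<open>The offset \<open>m\<close> covers two uses: \<open>m = a\<close> for the value of the
  Dyson product, \<open>m = 0\<close> for the interpolation denominator.\<close>

lemma prod_shift_qpoch:
  fixes q :: complex
  shows "(\<Prod>s<n. q ^ k - q ^ (k + (m + 1 + s))) = q ^ (k * n) * (\<Prod>s<n. 1 - q * q ^ (m + s))"
proof -
  have "(\<Prod>s<n. q ^ k - q ^ (k + (m + 1 + s))) = (\<Prod>s<n. q ^ k * (1 - q * q ^ (m + s)))"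
  proof (intro prod.cong refl)
    fix s
    have "q ^ (k + (m + 1 + s)) = q ^ k * (q * q ^ (m + s))" by (simp add: power_add mult_ac)
    then show "q ^ k - q ^ (k + (m + 1 + s)) = q ^ k * (1 - q * q ^ (m + s))"
      by (simp only: right_diff_distrib mult_1_right)
  qed
  then show ?thesis by (simp add: prod.distrib power_mult)
qed

lemma qpoch_add: "qpoch u q (m + n) = qpoch u q m * (\<Prod>s<n. 1 - u * q ^ (m + s))"
  by (simp add: qpoch_def prod_lessThan_add)

lemma prod_upper_swap:
  "(\<Prod>i<N. \<Prod>j\<in>{i<..<N::nat}. f i j) = (\<Prod>j<N. \<Prod>i<j. f i j :: 'a::comm_monoid_mult)"
proof -
  have "(\<Prod>i<N. \<Prod>j\<in>{i<..<N}. f i j) = (\<Prod>i<N. \<Prod>j\<in>{j \<in> {..<N}. i < j}. f i j)"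
    by (intro prod.cong) auto
  also have "\<dots> = (\<Prod>j<N. \<Prod>i\<in>{i \<in> {..<N}. i < j}. f i j)"
    by (rule prod.swap_restrict) auto
  also have "\<dots> = (\<Prod>j<N. \<Prod>i<j. f i j)"
    by (intro prod.cong) auto
  finally show ?thesis .
qed

text \<open>For fixed i the blocks of \<open>a\<close> factors belonging to successive partners tile
  a contiguous range of exponents. The result is arranged to match \<open>prod_qpower_grid\<close>,
  so that most of it cancels in the quotient.\<close>

lemma dyson_at_grid_point:
  assumes x: "\<And>i. i < N \<Longrightarrow> x i = q ^ (i * a)"
  shows "dyson N a q x = (\<Prod>i<N. (\<Prod>s<i * a. q ^ (i * a) - q ^ s) *
     (q ^ (i * a * ((N - Suc i) * a)) * (\<Prod>s<(N - Suc i) * a. 1 - q * q ^ (a + s))))"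
proof -
  have "dyson N a q x = (\<Prod>i<N. \<Prod>j\<in>{i<..<N}.
     (\<Prod>t<a. q ^ (j * a) - q ^ (i * a + t)) * (\<Prod>t<a. q ^ (i * a) - q ^ (j * a + Suc t)))"
    unfolding dyson_def
    by (intro prod.cong arg_cong2[where f = "(*)"]) (simp_all add: x power_add)
  also have "\<dots> = (\<Prod>i<N. \<Prod>j\<in>{i<..<N}. \<Prod>t<a. q ^ (j * a) - q ^ (i * a + t)) *
      (\<Prod>i<N. \<Prod>j\<in>{i<..<N}. \<Prod>t<a. q ^ (i * a) - q ^ (j * a + Suc t))"
    by (simp only: prod.distrib)
  also have "(\<Prod>i<N. \<Prod>j\<in>{i<..<N}. \<Prod>t<a. q ^ (j * a) - q ^ (i * a + t)) =
      (\<Prod>j<N. \<Prod>s<j * a. q ^ (j * a) - q ^ s)"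
    unfolding prod_upper_swap
    by (intro prod.cong refl prod_blocks[where f = "\<lambda>s. q ^ (_ * a) - q ^ s"])
  also have "(\<Prod>i<N. \<Prod>j\<in>{i<..<N}. \<Prod>t<a. q ^ (i * a) - q ^ (j * a + Suc t)) =
      (\<Prod>i<N. q ^ (i * a * ((N - Suc i) * a)) * (\<Prod>s<(N - Suc i) * a. 1 - q * q ^ (a + s)))"
  proof (intro prod.cong refl)
    fix i assume "i \<in> {..<N}"
    then have i: "i < N" by simp
    have "(\<Prod>j\<in>{i<..<N}. \<Prod>t<a. q ^ (i * a) - q ^ (j * a + Suc t)) =
        (\<Prod>k<N - Suc i. \<Prod>t<a. q ^ (i * a) - q ^ ((Suc i + k) * a + Suc t))"
      by (rule prod.reindex_bij_witness[of _ "\<lambda>k. Suc i + k" "\<lambda>j. j - Suc i"]) (use i in auto)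
    \<comment> \<open>The exponents start at \<open>i * a + a + 1\<close> rather than
      \<open>i * a + a\<close>, because the second product in \<open>dyson\<close> runs over
      \<open>Suc t\<close>.\<close>
    also have "\<dots> = (\<Prod>k<N - Suc i. \<Prod>t<a. q ^ (i * a) - q ^ (i * a + (a + 1 + (k * a + t))))"
      by (simp add: algebra_simps)
    also have "\<dots> = (\<Prod>s<(N - Suc i) * a. q ^ (i * a) - q ^ (i * a + (a + 1 + s)))"
      by (rule prod_blocks)
    also have "\<dots> = q ^ (i * a * ((N - Suc i) * a)) * (\<Prod>s<(N - Suc i) * a. 1 - q * q ^ (a + s))"
      by (rule prod_shift_qpoch)
    finally show "(\<Prod>j\<in>{i<..<N}. \<Prod>t<a. q ^ (i * a) - q ^ (j * a + Suc t)) = \<dots>" .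
  qed
  finally show ?thesis by (simp only: prod.distrib)
qed

lemma prod_qpower_grid:
  assumes inj: "inj_on (\<lambda>t. q ^ t) {..d}" and k: "k \<le> d"
  shows "(\<Prod>b\<in>(\<lambda>t. q ^ t) ` {..d} - {q ^ k}. q ^ k - b) =
    (\<Prod>s<k. q ^ k - q ^ s) * (q ^ (k * (d - k)) * qpoch q q (d - k))"
proof -
  have "(\<lambda>t. q ^ t) ` {..d} - {q ^ k} = (\<lambda>t. q ^ t) ` ({..d} - {k})"
    using inj k by (auto dest: inj_onD)
  also have "(\<Prod>b\<in>(\<lambda>t. q ^ t) ` ({..d} - {k}). q ^ k - b) = (\<Prod>t\<in>{..d} - {k}. q ^ k - q ^ t)"
    by (rule prod.reindex[OF inj_on_subset[OF inj], unfolded o_def]) auto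
  also have "{..d} - {k} = {..<k} \<union> {k<..d}" using k by auto
  also have "(\<Prod>t\<in>\<dots>. q ^ k - q ^ t) = (\<Prod>s<k. q ^ k - q ^ s) * (\<Prod>t\<in>{k<..d}. q ^ k - q ^ t)"
    by (rule prod.union_disjoint) auto
  also have "(\<Prod>t\<in>{k<..d}. q ^ k - q ^ t) = (\<Prod>s<d - k. q ^ k - q ^ (k + (0 + 1 + s)))"
    by (rule prod.reindex_bij_witness[of _ "\<lambda>s. k + (0 + 1 + s)" "\<lambda>t. t - Suc k"]) auto
  also have "\<dots> = q ^ (k * (d - k)) * qpoch q q (d - k)"
    unfolding prod_shift_qpoch qpoch_def by simp
  finally show ?thesis .
qed

text \<open>For i < j the first product vanishes when \<open>\<alpha> j - \<alpha> i\<close> lies in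
  0, ..., a - 1, the second when \<open>\<alpha> i - \<alpha> j\<close> lies in 1, ..., a. What
  remains is the spacing condition of \<open>spaced_unique\<close>.\<close>

lemma dyson_nonzero_on_grid:
  assumes a: "a \<ge> 1" and nz: "dyson N a q c \<noteq> 0"
    and c: "\<And>i. i < N \<Longrightarrow> c i = q ^ \<alpha> i" and bd: "\<And>i. i < N \<Longrightarrow> \<alpha> i \<le> (N - 1) * a"
    and i: "i < N"
  shows "\<alpha> i = i * a"
proof -
  have gap: "\<alpha> j \<ge> \<alpha> i + a \<or> \<alpha> i \<ge> \<alpha> j + a + 1" if ij: "i < N" "j < N" "i < j" for i j
  proof (rule ccontr)
    assume *: "\<not> (\<alpha> j \<ge> \<alpha> i + a \<or> \<alpha> i \<ge> \<alpha> j + a + 1)"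
    have "(\<Prod>t<a. c j - c i * q ^ t) * (\<Prod>t<a. c i - c j * q ^ Suc t) = 0"
    proof (cases "\<alpha> i \<le> \<alpha> j")
      case True
      then have "c j - c i * q ^ (\<alpha> j - \<alpha> i) = 0"
        using ij by (simp add: c flip: power_add)
      moreover have "\<alpha> j - \<alpha> i < a" using * True by linarith
      ultimately have "(\<Prod>t<a. c j - c i * q ^ t) = 0"
        by (intro prod_zero) auto
      then show ?thesis by simp
    next
      case False
      then have "c i - c j * q ^ Suc (\<alpha> i - \<alpha> j - 1) = 0"
        using ij by (simp add: c Suc_diff_Suc flip: power_add power_Suc)
      moreover have "\<alpha> i - \<alpha> j - 1 < a" using * False by linarith
      ultimately have "(\<Prod>t<a. c i - c j * q ^ Suc t) = 0"
        by (intro prod_zero bexI[of _ "\<alpha> i - \<alpha> j - 1"]) auto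
      then show ?thesis by simp
    qed
    then have "(\<Prod>j\<in>{i<..<N}. (\<Prod>t<a. c j - c i * q ^ t) * (\<Prod>t<a. c i - c j * q ^ Suc t)) = 0"
      using ij by - (rule prod_zero, simp, rule bexI[of _ j], simp_all)
    then have "dyson N a q c = 0"
      unfolding dyson_def using ij by - (rule prod_zero, simp, rule bexI[of _ i], simp_all)
    with nz show False ..
  qed
  have "\<alpha> i = a * card {j \<in> {..<N}. j < i}"
    by (rule spaced_unique[OF a]) (use gap bd i in auto)
  also have "{j \<in> {..<N}. j < i} = {..<i}" using i by auto
  finally show ?thesis by simp
qed

lemma su_avg_dyson:
  assumes q: "norm q < 1" "q \<noteq> 0" and N: "N \<ge> 1" and a: "a \<ge> 1"
  shows "su_avg N (dyson N a q) = qpoch q q (N * a) / qpoch q q a ^ N"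
proof -
  \<comment> \<open>Total degree N d asks for d + 1 nodes per variable, here 1, q, ..., q^d. They
    are distinct because q is nonzero of norm below 1.\<close>
  define d where "d = (N - 1) * a"
  define C where "C = (\<lambda>t. q ^ t) ` {..d}"
  define c0 where "c0 = (\<lambda>i\<in>{..<N}. q ^ (i * a))"
  have inj: "inj_on (\<lambda>t. q ^ t) {..d}" using power_inj[OF q] by (auto intro: inj_onI)
  have C: "card C = Suc d" by (simp add: C_def card_image[OF inj])
  then have finC: "finite C" by (simp add: C_def)
  have ia: "i * a \<le> d" "d - i * a = (N - Suc i) * a" if "i < N" for i
    using that unfolding d_def by (auto simp flip: diff_mult_distrib)
  have c0: "c0 \<in> PiE {..<N} (\<lambda>_. C)"
    using ia by (auto simp: c0_def C_def)
  have zero: "dyson N a q c = 0" if c: "c \<in> PiE {..<N} (\<lambda>_. C)" "c \<noteq> c0" for c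
  proof (rule ccontr)
    assume nz: "dyson N a q c \<noteq> 0"
    have "\<forall>i\<in>{..<N}. \<exists>t\<le>d. c i = q ^ t" using PiE_mem[OF c(1)] unfolding C_def by auto
    then obtain \<alpha> where \<alpha>: "\<And>i. i < N \<Longrightarrow> c i = q ^ \<alpha> i" "\<And>i. i < N \<Longrightarrow> \<alpha> i \<le> (N - 1) * a"
      unfolding d_def by (metis lessThan_iff)
    have "c i = c0 i" for i
      using dyson_nonzero_on_grid[OF a nz \<alpha>] \<alpha>(1)[of i] c(1)
      by (cases "i < N") (auto simp: c0_def PiE_def extensional_def)
    with c(2) show False by auto
  qed
  have "su_avg N (dyson N a q) = grid_sum N C (dyson N a q)"
    using homog_dyson[of N a q] C N unfolding d_def by (rule su_avg_eq_grid_sum)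
  also have "\<dots> = (\<Sum>c\<in>PiE {..<N} (\<lambda>_. C). if c = c0 then
      dyson N a q c0 / (\<Prod>i<N. \<Prod>b\<in>C - {c0 i}. c0 i - b) else 0)"
    unfolding grid_sum_def by (intro sum.cong) (auto simp: zero)
  also have "\<dots> = dyson N a q c0 / (\<Prod>i<N. \<Prod>b\<in>C - {c0 i}. c0 i - b)"
    using c0 finC by (simp add: finite_PiE)
  also have "(\<Prod>i<N. \<Prod>b\<in>C - {c0 i}. c0 i - b) =
     (\<Prod>i<N. (\<Prod>s<i * a. q ^ (i * a) - q ^ s) *
       (q ^ (i * a * ((N - Suc i) * a)) * qpoch q q ((N - Suc i) * a)))"
  proof (intro prod.cong refl)
    fix i assume "i \<in> {..<N}"
    then have "c0 i = q ^ (i * a)" "i < N" by (auto simp: c0_def)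
    then show "(\<Prod>b\<in>C - {c0 i}. c0 i - b) = (\<Prod>s<i * a. q ^ (i * a) - q ^ s) *
       (q ^ (i * a * ((N - Suc i) * a)) * qpoch q q ((N - Suc i) * a))"
      using prod_qpower_grid[OF inj, of "i * a"] ia[of i] by (simp add: C_def)
  qed
  also have "dyson N a q c0 = (\<Prod>i<N. (\<Prod>s<i * a. q ^ (i * a) - q ^ s) *
     (q ^ (i * a * ((N - Suc i) * a)) * (\<Prod>s<(N - Suc i) * a. 1 - q * q ^ (a + s))))"
    by (rule dyson_at_grid_point) (simp add: c0_def)
  also have "(\<Prod>i<N. (\<Prod>s<i * a. q ^ (i * a) - q ^ s) *
     (q ^ (i * a * ((N - Suc i) * a)) * (\<Prod>s<(N - Suc i) * a. 1 - q * q ^ (a + s)))) /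
     (\<Prod>i<N. (\<Prod>s<i * a. q ^ (i * a) - q ^ s) *
       (q ^ (i * a * ((N - Suc i) * a)) * qpoch q q ((N - Suc i) * a))) =
     (\<Prod>i<N. (\<Prod>s<(N - Suc i) * a. 1 - q * q ^ (a + s)) / qpoch q q ((N - Suc i) * a))"
    unfolding prod_dividef[symmetric]
  proof (intro prod.cong refl)
    fix i
    have "(\<Prod>s<i * a. q ^ (i * a) - q ^ s) \<noteq> 0"
      using power_inj[OF q] by auto
    moreover have "q ^ (i * a * ((N - Suc i) * a)) \<noteq> 0" using q by simp
    ultimately show "(\<Prod>s<i * a. q ^ (i * a) - q ^ s) *
         (q ^ (i * a * ((N - Suc i) * a)) * (\<Prod>s<(N - Suc i) * a. 1 - q * q ^ (a + s))) /
         ((\<Prod>s<i * a. q ^ (i * a) - q ^ s) *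
          (q ^ (i * a * ((N - Suc i) * a)) * qpoch q q ((N - Suc i) * a))) =
         (\<Prod>s<(N - Suc i) * a. 1 - q * q ^ (a + s)) / qpoch q q ((N - Suc i) * a)"
      by (simp only: nonzero_mult_divide_mult_cancel_left not_False_eq_True)
  qed
  also have "\<dots> = (\<Prod>i<N. (\<Prod>s<i * a. 1 - q * q ^ (a + s)) / qpoch q q (i * a))"
    by (rule prod.nat_diff_reindex)
  \<comment> \<open>Splitting the first \<open>a\<close> factors off
    \<open>qpoch q q (Suc i * a)\<close> exposes ratios of consecutive values, which
    telescope.\<close>
  also have "\<dots> = (\<Prod>i<N. qpoch q q (Suc i * a) / qpoch q q a / qpoch q q (i * a))"
    using qpoch_nonzero[OF q(1)] by (intro prod.cong) (simp_all add: qpoch_add)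
  also have "\<dots> = qpoch q q (N * a) / qpoch q q a ^ N"
    using qpoch_nonzero[OF q(1)]
    by (induction N) (simp_all add: qpoch_def[of _ _ 0])
  finally show ?thesis .
qed

section \<open>Shifting the truncated theta products\<close>

text \<open>A truncated theta function. The two lengths are independent, since a shift of
  \<open>u\<close> by q lengthens one product and shortens the other.\<close>

definition qtheta :: "nat \<Rightarrow> nat \<Rightarrow> complex \<Rightarrow> complex \<Rightarrow> complex" where
  "qtheta a b q u = qpoch u q a * qpoch (q / u) q b"

lemma qpoch_Suc_head: "qpoch u q (Suc n) = (1 - u) * qpoch (q * u) q n"
  unfolding qpoch_def prod.lessThan_Suc_shift by (simp add: mult_ac)

text \<open>The head factor \<open>1 - 1 / u\<close> of the second product equals
  \<open>- (1 / u) * (1 - u)\<close>, and \<open>1 - u\<close> becomes the head of the first.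
  Quasi-periodicity is thus exact at finite length, at the price of changed lengths.\<close>

lemma qtheta_shift:
  assumes "q \<noteq> 0" "u \<noteq> 0"
  shows "qtheta a (Suc b) q (q * u) = - (1 / u) * qtheta (Suc a) b q u"
proof -
  have "qtheta a (Suc b) q (q * u) = (1 - 1 / u) * (qpoch (q * u) q a * qpoch (q / u) q b)"
    using assms by (simp add: qtheta_def qpoch_Suc_head)
  also have "1 - 1 / u = - (1 / u) * (1 - u)"
    using assms by (simp add: field_simps)
  finally show ?thesis by (simp add: qtheta_def qpoch_Suc_head)
qed

lemma qtheta_shift_power:
  assumes "q \<noteq> 0" "u \<noteq> 0"
  shows "u ^ n * q ^ (\<Sum>k<n. k) * qtheta a (b + n) q (q ^ n * u) = (-1) ^ n * qtheta (a + n) b q u"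
proof (induction n arbitrary: a)
  case (Suc n)
  have "u ^ Suc n * q ^ (\<Sum>k<Suc n. k) * qtheta a (b + Suc n) q (q ^ Suc n * u) =
      u ^ Suc n * q ^ (\<Sum>k<Suc n. k) * (- (1 / (q ^ n * u)) * qtheta (Suc a) (b + n) q (q ^ n * u))"
    using qtheta_shift[OF assms(1), of "q ^ n * u" a "b + n"] assms by (simp add: mult.assoc)
  also have "\<dots> = - (u ^ n * q ^ (\<Sum>k<n. k) * qtheta (Suc a) (b + n) q (q ^ n * u))"
    using assms by (simp add: power_add)
  also have "\<dots> = (-1) ^ Suc n * qtheta (a + Suc n) b q u"
    unfolding Suc.IH by simp
  finally show ?case .
qed simp

lemma sum_lessThan_int: "int (\<Sum>k<n. k) = int n * (int n - 1) div 2"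
proof -
  have "2 * int (\<Sum>k<n. k) = int n * (int n - 1)"
    by (induction n) (simp_all add: algebra_simps)
  then show ?thesis by simp
qed

text \<open>The bounds on \<open>l\<close> keep both shifted lengths nonnegative, so
  \<open>nat\<close> cuts nothing off.\<close>

lemma qtheta_shift_int:
  assumes "q \<noteq> 0" "u \<noteq> 0" "- int a \<le> l" "l \<le> int b"
  shows "qtheta a b q (q powi l * u) =
    (-1) powi l * (1 / u) powi l * q powi (- (l * (l - 1) div 2)) * qtheta (nat (int a + l)) (nat (int b - l)) q u"
proof (cases "l \<ge> 0")
  case True
  then obtain n where l: "l = int n" by (metis nonneg_int_cases)
  then obtain b' where b: "b = b' + n" using assms(4) by (metis le_add_diff_inverse2 of_nat_le_iff)
  have 1: "nat (int a + l) = a + n" "nat (int b - l) = b'" by (auto simp: l b)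
  have 2: "q powi (- (l * (l - 1) div 2)) = 1 / q ^ (\<Sum>k<n. k)"
    unfolding l sum_lessThan_int[symmetric] power_int_minus power_int_of_nat by (rule inverse_eq_divide)
  have "u ^ n * q ^ (\<Sum>k<n. k) * qtheta a b q (q ^ n * u) = (-1) ^ n * qtheta (a + n) b' q u"
    unfolding b by (rule qtheta_shift_power[OF assms(1,2)])
  moreover have "u ^ n * q ^ (\<Sum>k<n. k) \<noteq> 0" using assms by simp
  ultimately show ?thesis unfolding 1 2 unfolding l
    by (simp add: field_simps)
next
  case False
  then obtain n where l: "l = - int n" by (metis int_cases4 of_nat_0_le_iff)
  then obtain a' where a: "a = a' + n" using assms(3)
    by (metis le_add_diff_inverse2 neg_le_iff_le of_nat_le_iff)
  \<comment> \<open>For negative \<open>l\<close> the shift is read backwards: \<open>u\<close>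
    arises from \<open>v\<close> by \<open>n\<close> positive shifts, so
    \<open>qtheta_shift_power\<close> applies to \<open>v\<close>.\<close>
  define v where "v = q powi l * u"
  have v: "v \<noteq> 0" "u = q ^ n * v" using assms by (simp_all add: v_def l power_int_minus)
  have 1: "nat (int a + l) = a'" "nat (int b - l) = b + n" by (auto simp: l a nat_add_distrib)
  have 2: "l * (l - 1) div 2 = int (n * n) - int (\<Sum>k<n. k)"
  proof -
    have "l * (l - 1) = 2 * (int (n * n) - int (\<Sum>k<n. k))"
      unfolding l by (induction n) (simp_all add: algebra_simps)
    then show ?thesis by simp
  qed
  have 3: "q powi (- (l * (l - 1) div 2)) = q ^ (\<Sum>k<n. k) / q ^ (n * n)"
    unfolding 2 by (simp only: minus_diff_eq power_int_diff[OF disjI1[OF assms(1)]] power_int_of_nat)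
  have "qtheta a b q v = (-1) ^ n * ((-1) ^ n * qtheta (a' + n) b q v)"
    by (simp add: a flip: power_mult_distrib mult.assoc)
  also have "\<dots> = (-1) ^ n * (v ^ n * q ^ (\<Sum>k<n. k) * qtheta a' (b + n) q u)"
    unfolding v(2) by (simp only: qtheta_shift_power[OF assms(1) v(1)])
  also have "v ^ n = u ^ n / q ^ (n * n)"
    using assms by (simp add: v(2) power_mult_distrib power_mult)
  finally have "qtheta a b q v = (-1) ^ n * (u ^ n / q ^ (n * n) * q ^ (\<Sum>k<n. k) * qtheta a' (b + n) q u)" .
  moreover have "(-1 :: complex) powi (- int n) = (-1) ^ n"
    by (simp add: power_int_minus flip: power_inverse)
  ultimately show ?thesis unfolding 1 3 v_def[symmetric]
    unfolding l by (simp only:) (simp add: power_int_minus field_simps)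
qed

text \<open>For p < r, multiplying \<open>x i\<close> by \<open>q powi (- l)\<close> multiplies the
  ratio \<open>x p / x r\<close> by q to this power.\<close>

definition pair_shift :: "nat \<Rightarrow> int \<Rightarrow> nat \<Rightarrow> nat \<Rightarrow> int" where
  "pair_shift i l p r = (if p = i then - l else if r = i then l else 0)"

lemma pair_shift_0 [simp]: "pair_shift i 0 p r = 0"
  by (simp add: pair_shift_def)

text \<open>The lengths for pairs containing \<open>i\<close> are offset by exactly what the
  rescaling of \<open>x i\<close> produces from equal lengths \<open>a\<close>; \<open>l = 0\<close>
  gives the equal-length product.\<close>

definition theta_prod :: "nat \<Rightarrow> nat \<Rightarrow> nat \<Rightarrow> int \<Rightarrow> complex \<Rightarrow> (nat \<Rightarrow> complex) \<Rightarrow> complex" where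
  "theta_prod N a i l q x = (\<Prod>p<N. \<Prod>r\<in>{p<..<N}.
     qtheta (nat (int a + pair_shift i l p r)) (nat (int a - pair_shift i l p r)) q (x p / x r))"

lemma prod_pairs_mult:
  "(\<Prod>p<N. \<Prod>r\<in>{p<..<N}. h p * h r) = (\<Prod>p<N. h p :: complex) ^ (N - 1)"
proof -
  have "(\<Prod>p<N. \<Prod>r\<in>{p<..<N}. h p * h r) =
      (\<Prod>p<N. \<Prod>r\<in>{p<..<N}. h p) * (\<Prod>p<N. \<Prod>r\<in>{p<..<N}. h r)"
    by (simp only: prod.distrib)
  also have "(\<Prod>p<N. \<Prod>r\<in>{p<..<N}. h r) = (\<Prod>r<N. h r ^ r)"
    by (simp add: prod_upper_swap)
  also have "(\<Prod>p<N. \<Prod>r\<in>{p<..<N}. h p) = (\<Prod>p<N. h p ^ (N - Suc p))"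
    by simp
  also have "\<dots> * (\<Prod>r<N. h r ^ r) = (\<Prod>p<N. h p ^ (N - 1))"
    unfolding prod.distrib[symmetric] power_add[symmetric]
    by (intro prod.cong arg_cong2[where f = power]) auto
  finally show ?thesis by (simp add: prod_power_distrib)
qed

text \<open>The prefactor is 1 on the torus but in general not after one coordinate has been
  rescaled, hence the statement for general nonzero points.\<close>

lemma dyson_eq_theta_prod:
  assumes nz: "\<And>i. i < N \<Longrightarrow> y i \<noteq> 0"
  shows "dyson N a q y = (\<Prod>p<N. y p) ^ ((N - 1) * a) * theta_prod N a i 0 q y"
proof -
  have factor: "(\<Prod>t<a. y r - y p * q ^ t) * (\<Prod>t<a. y p - y r * q ^ Suc t) =
      y p ^ a * y r ^ a * qtheta a a q (y p / y r)" if "p < N" "r < N" for p r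
  proof -
    have "(\<Prod>t<a. y r - y p * q ^ t) = (\<Prod>t<a. y r * (1 - y p / y r * q ^ t))"
      "(\<Prod>t<a. y p - y r * q ^ Suc t) = (\<Prod>t<a. y p * (1 - q / (y p / y r) * q ^ t))"
      using nz that by (auto intro!: prod.cong simp: field_simps)
    then show ?thesis by (simp add: prod.distrib qtheta_def qpoch_def)
  qed
  have "dyson N a q y = (\<Prod>p<N. \<Prod>r\<in>{p<..<N}. y p ^ a * y r ^ a * qtheta a a q (y p / y r))"
    unfolding dyson_def by (intro prod.cong refl factor) auto
  also have "\<dots> = (\<Prod>p<N. \<Prod>r\<in>{p<..<N}. y p ^ a * y r ^ a) * theta_prod N a i 0 q y"
    by (simp only: prod.distrib theta_prod_def pair_shift_0) simp
  also have "(\<Prod>p<N. \<Prod>r\<in>{p<..<N}. y p ^ a * y r ^ a) = (\<Prod>p<N. y p) ^ ((N - 1) * a)"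
    by (simp add: prod_pairs_mult power_mult mult.commute[of _ a] flip: prod_power_distrib)
  finally show ?thesis .
qed

lemma prod_pairs_at:
  fixes i N :: nat
  assumes "i < N"
  shows "(\<Prod>p<N. \<Prod>r\<in>{p<..<N}. if p = i then f r else if r = i then g p else 1) =
    (\<Prod>r\<in>{i<..<N}. f r) * (\<Prod>p<i. g p :: complex)"
proof -
  have "(\<Prod>p<N. \<Prod>r\<in>{p<..<N}. if p = i then f r else if r = i then g p else 1) =
      (\<Prod>p<N. (if p = i then \<Prod>r\<in>{i<..<N}. f r else 1) * (if p < i then g p else 1))"
  proof (intro prod.cong refl)
    fix p assume "p \<in> {..<N}"
    show "(\<Prod>r\<in>{p<..<N}. if p = i then f r else if r = i then g p else 1) =
        (if p = i then \<Prod>r\<in>{i<..<N}. f r else 1) * (if p < i then g p else 1)"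
      using assms by (cases "p = i") simp_all
  qed
  also have "\<dots> = (\<Prod>r\<in>{i<..<N}. f r) * (\<Prod>p<N. if p < i then g p else 1)"
    using assms by (simp add: prod.distrib)
  also have "(\<Prod>p<N. if p < i then g p else 1) = (\<Prod>p<i. g p)"
    using assms by (intro prod.mono_neutral_cong_right) auto
  finally show ?thesis .
qed

lemma prod_power_int: "(\<Prod>r\<in>A. (f r :: complex) powi l) = (\<Prod>r\<in>A. f r) powi l"
  by (induction A rule: infinite_finite_induct) (simp_all add: power_int_mult_distrib)

text \<open>Up to sign, the q-exponent collected from the pairs containing \<open>i\<close>: the
  \<open>N - Suc i\<close> pairs (i, r) are shifted by \<open>- l\<close>, the \<open>i\<close>
  pairs (p, i) by \<open>l\<close>.\<close>

definition wilson_exponent :: "nat \<Rightarrow> nat \<Rightarrow> int \<Rightarrow> int" where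
  "wilson_exponent N i l = int (N - Suc i) * (l * (l + 1) div 2) + int i * (l * (l - 1) div 2)"

lemma theta_prod_scale:
  assumes q: "q \<noteq> 0" and x: "on_su N x" and i: "i < N" and a: "\<bar>l\<bar> \<le> int a"
  shows "theta_prod N a i 0 q (x(i := q powi (- l) * x i)) =
    (-1) powi (l * (int N - 1)) * q powi (- wilson_exponent N i l) * x i powi (l * int N) *
    theta_prod N a i l q x"
proof -
  have nz: "x p \<noteq> 0" if "p < N" for p using x that by (auto simp: on_su_def)
  define y where "y = x(i := q powi (- l) * x i)"
  \<comment> \<open>Shifts by \<open>- l\<close> for (i, r) and by \<open>l\<close> for (p, i) yield
    the same sign and the same factor in x; only the powers of q in \<open>f\<close> and
    \<open>g\<close> differ.\<close>
  define u where "u r = (-1) powi l * (x i / x r) powi l" for r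
  define f where "f r = u r * q powi (- (l * (l + 1) div 2))" for r
  define g where "g p = u p * q powi (- (l * (l - 1) div 2))" for p
  let ?s = "pair_shift i l"
  have "qtheta a a q (y p / y r) = (if p = i then f r else if r = i then g p else 1) *
      qtheta (nat (int a + ?s p r)) (nat (int a - ?s p r)) q (x p / x r)"
    if pr: "p < N" "r < N" "p < r" for p r
  proof -
    have "y p / y r = q powi ?s p r * (x p / x r)"
      using pr q by (auto simp: y_def pair_shift_def power_int_minus field_simps)
    moreover have "- int a \<le> ?s p r" "?s p r \<le> int a"
      using a by (auto simp: pair_shift_def)
    moreover have "x p / x r \<noteq> 0" using nz pr by simp
    ultimately have "qtheta a a q (y p / y r) = (-1) powi ?s p r * (1 / (x p / x r)) powi ?s p r *
        q powi (- (?s p r * (?s p r - 1) div 2)) *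
        qtheta (nat (int a + ?s p r)) (nat (int a - ?s p r)) q (x p / x r)"
      by (metis qtheta_shift_int[OF q])
    moreover have "(-1) powi ?s p r * (1 / (x p / x r)) powi ?s p r *
        q powi (- (?s p r * (?s p r - 1) div 2)) = (if p = i then f r else if r = i then g p else 1)"
    proof (cases "p = i")
      case True
      have "(-1 :: complex) powi (- l) = (-1) powi l"
        by (simp add: power_int_minus flip: power_int_inverse)
      moreover have "(1 / (x p / x r)) powi (- l) = (x p / x r) powi l"
        by (simp add: power_int_minus flip: power_int_inverse)
      moreover have "- l * (- l - 1) = l * (l + 1)" by (simp add: algebra_simps)
      ultimately show ?thesis using True by (simp add: pair_shift_def f_def u_def)
    next
      case False
      then show ?thesis by (auto simp: pair_shift_def g_def u_def)
    qed
    ultimately show ?thesis by (simp only:)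
  qed
  then have "theta_prod N a i 0 q y = (\<Prod>p<N. \<Prod>r\<in>{p<..<N}. (if p = i then f r else if r = i then g p else 1) *
      qtheta (nat (int a + ?s p r)) (nat (int a - ?s p r)) q (x p / x r))"
    unfolding theta_prod_def by (intro prod.cong) simp_all
  also have "\<dots> = (\<Prod>r\<in>{i<..<N}. f r) * (\<Prod>p<i. g p) * theta_prod N a i l q x"
    unfolding theta_prod_def prod.distrib prod_pairs_at[OF i] ..
  also have "(\<Prod>r\<in>{i<..<N}. f r) * (\<Prod>p<i. g p) =
      (\<Prod>r\<in>{..<N} - {i}. u r) * q powi (- wilson_exponent N i l)"
  proof -
    have "(\<Prod>r\<in>{..<N} - {i}. u r) = (\<Prod>r\<in>{i<..<N} \<union> {..<i}. u r)"
      using i by (intro prod.cong) auto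
    also have "\<dots> = (\<Prod>r\<in>{i<..<N}. u r) * (\<Prod>r<i. u r)"
      by (rule prod.union_disjoint) auto
    finally have 1: "(\<Prod>r\<in>{..<N} - {i}. u r) = (\<Prod>r\<in>{i<..<N}. u r) * (\<Prod>r<i. u r)" .
    have 2: "q powi (- wilson_exponent N i l) =
        (q powi (- (l * (l + 1) div 2))) ^ (N - Suc i) * (q powi (- (l * (l - 1) div 2))) ^ i"
    proof -
      have "- wilson_exponent N i l =
          - (l * (l + 1) div 2) * int (N - Suc i) + - (l * (l - 1) div 2) * int i"
        by (simp add: wilson_exponent_def)
      then show ?thesis
        by (simp only: power_int_add[OF disjI1[OF q]] power_int_mult power_int_of_nat)
    qed
    show ?thesis unfolding 1 2 f_def g_def prod.distrib by simp
  qed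
  also have "(\<Prod>r\<in>{..<N} - {i}. u r) = (-1) powi (l * (int N - 1)) * x i powi (l * int N)"
  proof -
    \<comment> \<open>The coordinates multiply to 1, so those other than \<open>x i\<close> multiply
      to \<open>1 / x i\<close>, and the ratios \<open>x i / x r\<close> multiply to
      \<open>x i ^ N\<close>. This is the source of the exponent \<open>l * N\<close>.\<close>
    have "(\<Prod>r<N. x r) = x i * (\<Prod>r\<in>{..<N} - {i}. x r)"
      using i by (intro prod.remove) auto
    then have 1: "(\<Prod>r\<in>{..<N} - {i}. x r) = 1 / x i"
      using x nz[OF i] by (simp add: on_su_def field_simps)
    have "(\<Prod>r\<in>{..<N} - {i}. u r) = ((-1) powi l) ^ (N - 1) * (\<Prod>r\<in>{..<N} - {i}. x i / x r) powi l"
      using i by (simp add: u_def prod.distrib prod_power_int)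
    also have "(\<Prod>r\<in>{..<N} - {i}. x i / x r) = x i ^ (N - 1) * x i"
      using i by (simp add: prod_dividef 1)
    also have "\<dots> = x i ^ N" using i by (cases N) auto
    finally show ?thesis using i by (simp add: power_int_mult mult.commute[of l] flip: power_int_of_nat power_int_mult)
  qed
  finally show ?thesis unfolding y_def by (simp only: mult_ac)
qed

text \<open>The Laurent expression is replaced by a polynomial \<open>h\<close> that agrees with it
  on the torus, so that the averaging rules for \<open>homog\<close> apply.\<close>

lemma su_avg_theta_prod:
  assumes q: "norm q < 1" "q \<noteq> 0" and i: "i < N" and a: "\<bar>l\<bar> \<le> int a" "a \<ge> 1"
  obtains h D where "homog N D h"
    "\<And>x. on_su N x \<Longrightarrow> h x = x i powi (l * int N) * theta_prod N a i l q x"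
    "su_avg N h = (-1) powi (l * (int N - 1)) * q powi wilson_exponent N i l *
       (qpoch q q (N * a) / qpoch q q a ^ N)"
proof
  define c where "c = q powi (- l)"
  define d where "d = (N - 1) * a"
  \<comment> \<open>\<open>K\<close> undoes the sign and power of q from
    \<open>theta_prod_scale\<close>, and the factor \<open>c ^ d\<close> from the rescaled product
    of coordinates. In the average the same \<open>c ^ d\<close> returns through
    \<open>su_avg_scale\<close> and cancels.\<close>
  define K where "K = (-1) powi (l * (int N - 1)) * q powi wilson_exponent N i l / c ^ d"
  have c: "c \<noteq> 0" using q by (simp add: c_def)
  define h where "h x = K * dyson N a q (x(i := c * x i))" for x
  show "homog N (N * d) h"
    unfolding h_def [abs_def] d_def by (intro homog_cmult homog_scale homog_dyson)
  show "h x = x i powi (l * int N) * theta_prod N a i l q x" if x: "on_su N x" for x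
  proof -
    let ?y = "x(i := c * x i)"
    have nz: "x p \<noteq> 0" if "p < N" for p using x that by (auto simp: on_su_def)
    have "(\<Prod>p<N. ?y p) = (\<Prod>p<N. (if p = i then c else 1) * x p)"
      by (intro prod.cong) auto
    also have "\<dots> = c" using i x by (simp add: prod.distrib on_su_def)
    finally have "dyson N a q ?y = c ^ d * theta_prod N a i 0 q ?y"
      using dyson_eq_theta_prod[of N ?y a q i] nz c by (simp add: d_def)
    also have "theta_prod N a i 0 q ?y = (-1) powi (l * (int N - 1)) * q powi (- wilson_exponent N i l) *
        x i powi (l * int N) * theta_prod N a i l q x"
      unfolding c_def by (rule theta_prod_scale[OF q(2) x i a(1)])
    finally have dy: "dyson N a q ?y = c ^ d * ((-1) powi (l * (int N - 1)) * q powi (- wilson_exponent N i l) *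
        x i powi (l * int N) * theta_prod N a i l q x)" .
    have "h x = ((-1) powi (l * (int N - 1)) * (-1) powi (l * (int N - 1))) *
        (q powi wilson_exponent N i l * q powi (- wilson_exponent N i l)) *
        (x i powi (l * int N) * theta_prod N a i l q x)"
      using c unfolding h_def K_def dy by (simp add: field_simps)
    moreover have "((-1 :: complex) powi k * (-1) powi k) = 1" for k :: int
      by (simp flip: power_int_mult_distrib)
    moreover have "q powi wilson_exponent N i l * q powi (- wilson_exponent N i l) = 1"
      using q by (simp add: power_int_minus)
    ultimately show ?thesis by (simp only: mult_1_left)
  qed
  have "su_avg N h = K * (c ^ d * su_avg N (dyson N a q))"
    unfolding h_def [abs_def] su_avg_cmult
    by (subst su_avg_scale[OF homog_dyson[of N a q, folded d_def] i]) simp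
  then show "su_avg N h = (-1) powi (l * (int N - 1)) * q powi wilson_exponent N i l *
       (qpoch q q (N * a) / qpoch q q a ^ N)"
    using c su_avg_dyson[OF q _ a(2), of N] i by (simp add: K_def)
qed

section \<open>Passage to infinite products\<close>

lemma qpoch_inf_convergent:
  fixes u q :: complex
  assumes "norm q < 1"
  shows "convergent_prod (\<lambda>k. 1 - u * q ^ k)"
proof (rule abs_convergent_prod_imp_convergent_prod, rule summable_imp_abs_convergent_prod)
  have "summable (\<lambda>k. norm u * norm q ^ k)"
    using assms by (intro summable_mult summable_geometric) simp
  then show "summable (\<lambda>k. norm (1 - u * q ^ k - 1))"
    by (simp add: norm_mult norm_power)
qed

lemma qpoch_tendsto:
  assumes "norm q < 1"
  shows "qpoch u q \<longlonglongrightarrow> qpoch_inf u q"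
  using convergent_prod_LIMSEQ[OF qpoch_inf_convergent[OF assms, of u]]
  by (subst filterlim_sequentially_Suc[symmetric]) (simp add: qpoch_def [abs_def] qpoch_inf_def lessThan_Suc_atMost)

lemma qpoch_tendsto_compose:
  assumes "norm q < 1" "filterlim f at_top sequentially"
  shows "(\<lambda>n. qpoch u q (f n)) \<longlonglongrightarrow> qpoch_inf u q"
  by (rule filterlim_compose[OF qpoch_tendsto[OF assms(1)] assms(2)])

lemma qpoch_inf_head:
  assumes "norm q < 1"
  shows "qpoch_inf u q = (1 - u) * qpoch_inf (q * u) q"
proof (rule LIMSEQ_unique)
  show "(\<lambda>n. qpoch u q (Suc n)) \<longlonglongrightarrow> qpoch_inf u q"
    by (rule LIMSEQ_Suc[OF qpoch_tendsto[OF assms]])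
  show "(\<lambda>n. qpoch u q (Suc n)) \<longlonglongrightarrow> (1 - u) * qpoch_inf (q * u) q"
    unfolding qpoch_Suc_head by (intro tendsto_intros qpoch_tendsto assms)
qed

lemma qpoch_inf_one: "norm q < 1 \<Longrightarrow> qpoch_inf 1 q = 0"
  using qpoch_inf_head[of q 1] by simp

lemma qpoch_at_0: "n \<ge> 1 \<Longrightarrow> qpoch u 0 n = 1 - u"
  by (cases n) (simp_all add: qpoch_Suc_head, simp add: qpoch_def)

lemma qpoch_inf_at_0: "qpoch_inf u 0 = 1 - u"
proof (rule LIMSEQ_unique)
  show "(\<lambda>n. qpoch u 0 (Suc n)) \<longlonglongrightarrow> qpoch_inf u 0"
    by (rule LIMSEQ_Suc[OF qpoch_tendsto]) simp
qed (simp add: qpoch_at_0)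

lemma qpoch_inf_nonzero:
  assumes "norm q < 1"
  shows "qpoch_inf q q \<noteq> 0"
proof -
  have "1 - q * q ^ k \<noteq> 0" for k
    using power_neq_one[OF assms, of "Suc k"] by simp
  then show ?thesis
    unfolding qpoch_inf_def by (intro prodinf_nonzero qpoch_inf_convergent assms)
qed

text \<open>Each factor is at most 1 + r^k, hence at most exp (r^k); sum the geometric series. The
  bound is uniform in q as well, since dominated convergence is also applied with varying q.\<close>

lemma norm_qpoch_le:
  assumes "norm u \<le> 1" "norm q \<le> r" "r < 1"
  shows "norm (qpoch u q n) \<le> exp (1 / (1 - r))"
proof -
  have r: "r \<ge> 0" using assms(2) norm_ge_zero order_trans by blast
  have "norm (qpoch u q n) = (\<Prod>k<n. norm (1 - u * q ^ k))"
    by (simp add: qpoch_def prod_norm)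
  also have "\<dots> \<le> (\<Prod>k<n. exp (r ^ k))"
  proof (intro prod_mono conjI norm_ge_zero)
    fix k
    have "norm (1 - u * q ^ k) \<le> 1 + norm u * norm q ^ k"
      using norm_triangle_ineq4[of 1 "u * q ^ k"] by (simp add: norm_mult norm_power)
    also have "\<dots> \<le> 1 + 1 * r ^ k"
      using assms by (intro add_left_mono mult_mono power_mono) auto
    also have "\<dots> \<le> exp (r ^ k)" using exp_ge_add_one_self[of "r ^ k"] by simp
    finally show "norm (1 - u * q ^ k) \<le> exp (r ^ k)" .
  qed
  also have "\<dots> = exp (\<Sum>k<n. r ^ k)" by (simp add: exp_sum)
  also have "(\<Sum>k<n. r ^ k) \<le> (\<Sum>k. r ^ k)"
    using r assms(3) by (intro sum_le_suminf summable_geometric) auto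
  also have "\<dots> = 1 / (1 - r)" using r assms(3) by (intro suminf_geometric) auto
  finally show ?thesis by simp
qed

section \<open>Limits of truncated theta products and their averages\<close>

definition theta_inf :: "nat \<Rightarrow> complex \<Rightarrow> (nat \<Rightarrow> complex) \<Rightarrow> complex" where
  "theta_inf N q x = (\<Prod>p<N. \<Prod>r\<in>{p<..<N}. qpoch_inf (x p / x r) q * qpoch_inf (q / (x p / x r)) q)"

lemma norm_theta_prod_le:
  assumes x: "on_su N x" and r: "norm q \<le> r" "r < 1"
  shows "norm (theta_prod N a i l q x) \<le>
    (\<Prod>p<N. \<Prod>s\<in>{p<..<N}. exp (1 / (1 - r)) * exp (1 / (1 - r)))"
proof -
  have "norm (qtheta A B q (x p / x s)) \<le> exp (1 / (1 - r)) * exp (1 / (1 - r))" if "p < N" "s < N" for A B p s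
  proof -
    have "norm (x p / x s) = 1" "norm (q / (x p / x s)) \<le> 1"
      using x that r by (simp_all add: on_su_def norm_divide norm_mult)
    then show ?thesis
      unfolding qtheta_def norm_mult using r by (intro mult_mono norm_qpoch_le) auto
  qed
  then show ?thesis
    unfolding theta_prod_def prod_norm[symmetric] by (intro prod_mono conjI norm_ge_zero prod_nonneg) auto
qed

text \<open>A fixed offset of a truncation length is invisible in the limit, so the unequal lengths
  lead to the same infinite product for all \<open>i\<close> and \<open>l\<close>.\<close>

lemma theta_prod_tendsto:
  assumes q: "norm q < 1" and f: "filterlim f at_top sequentially"
  shows "(\<lambda>n. theta_prod N (f n) i l q x) \<longlonglongrightarrow> theta_inf N q x"
proof -
  have "filterlim (\<lambda>n. nat (int (f n) + k)) at_top sequentially" for k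
    unfolding filterlim_at_top
  proof
    fix Z
    from f have "\<forall>\<^sub>F n in sequentially. Z + nat \<bar>k\<bar> \<le> f n"
      by (simp add: filterlim_at_top)
    then show "\<forall>\<^sub>F n in sequentially. Z \<le> nat (int (f n) + k)"
      by eventually_elim linarith
  qed
  note lim = this this[of "- k" for k, simplified]
  show ?thesis
    unfolding theta_prod_def theta_inf_def qtheta_def
    by (intro tendsto_prod tendsto_mult qpoch_tendsto_compose q lim)
qed

text \<open>Both the length and the base may vary with n, so one statement serves growing lengths at
  fixed q and q tending to 0 at fixed length.\<close>

lemma su_avg_theta_limit:
  assumes i: "i < N" and l: "\<And>n. \<bar>l\<bar> \<le> int (as n)" "\<And>n. as n \<ge> 1"
    and qs: "\<And>n. qs n \<noteq> 0" "\<And>n. norm (qs n) \<le> r" "r < 1"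
    and F: "\<And>x. on_su N x \<Longrightarrow> (\<lambda>n. theta_prod N (as n) i l (qs n) x) \<longlonglongrightarrow> F x"
    and R: "(\<lambda>n. qs n powi wilson_exponent N i l *
       (qpoch (qs n) (qs n) (N * as n) / qpoch (qs n) (qs n) (as n) ^ N)) \<longlonglongrightarrow> R"
  shows "su_avg N (\<lambda>x. x i powi (l * int N) * F x) = (-1) powi (l * (int N - 1)) * R"
proof -
  have "\<exists>h D. homog N D h \<and>
      (\<forall>x. on_su N x \<longrightarrow> h x = x i powi (l * int N) * theta_prod N (as n) i l (qs n) x) \<and>
      su_avg N h = (-1) powi (l * (int N - 1)) * qs n powi wilson_exponent N i l *
       (qpoch (qs n) (qs n) (N * as n) / qpoch (qs n) (qs n) (as n) ^ N)" for n
  proof -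
    have "norm (qs n) < 1" using qs(2)[of n] qs(3) by linarith
    from su_avg_theta_prod[OF this qs(1) i l(1) l(2)] show ?thesis by metis
  qed
  then obtain h D where h: "\<And>n. homog N (D n) (h n)"
    "\<And>n x. on_su N x \<Longrightarrow> h n x = x i powi (l * int N) * theta_prod N (as n) i l (qs n) x"
    "\<And>n. su_avg N (h n) = (-1) powi (l * (int N - 1)) * qs n powi wilson_exponent N i l *
       (qpoch (qs n) (qs n) (N * as n) / qpoch (qs n) (qs n) (as n) ^ N)"
    by metis
  have N: "N \<ge> 1" using i by simp
  have "(\<lambda>n. su_avg N (h n)) \<longlonglongrightarrow> su_avg N (\<lambda>x. x i powi (l * int N) * F x)"
  proof (rule su_avg_limit(1)[OF N h(1)])
    show "norm (h n x) \<le> (\<Prod>p<N. \<Prod>s\<in>{p<..<N}. exp (1 / (1 - r)) * exp (1 / (1 - r)))"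
      if "on_su N x" for n x
      using norm_theta_prod_le[OF that qs(2,3)] that i
      by (simp add: h(2)[OF that] norm_mult norm_power_int on_su_def)
    show "(\<lambda>n. h n x) \<longlonglongrightarrow> x i powi (l * int N) * F x" if "on_su N x" for x
      unfolding h(2)[OF that] by (intro tendsto_intros F that)
  qed
  moreover have "(\<lambda>n. su_avg N (h n)) \<longlonglongrightarrow> (-1) powi (l * (int N - 1)) * R"
    unfolding h(3) mult.assoc by (intro tendsto_intros R)
  ultimately show ?thesis by (rule LIMSEQ_unique)
qed

lemma int_mult_Suc_nonneg: "(0::int) \<le> l * (l + 1) div 2"
proof -
  have "0 \<le> l * (l + 1)"
    by (cases "l \<ge> 0") (auto intro!: mult_nonneg_nonneg mult_nonpos_nonpos)
  then show ?thesis by simp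
qed

text \<open>It turns the integer power of q into an ordinary power, which is continuous at q =
  0.\<close>

lemma wilson_exponent_nonneg: "0 \<le> wilson_exponent N i l"
  unfolding wilson_exponent_def
  using int_mult_Suc_nonneg[of l] int_mult_Suc_nonneg[of "l - 1"]
  by (intro add_nonneg_nonneg mult_nonneg_nonneg) (simp_all add: mult.commute)

text \<open>The Dyson quotient \<open>(q; q)_(N a) / (q; q)_a ^ N\<close> tends to
  \<open>1 / (q; q)_inf ^ (N - 1)\<close>, which will cancel the prefactor of the integral.\<close>

lemma su_avg_theta_inf:
  assumes q: "norm q < 1" and i: "i < N"
  shows "su_avg N (\<lambda>x. x i powi (l * int N) * theta_inf N q x) =
    (-1) powi (l * (int N - 1)) * (q ^ nat (wilson_exponent N i l) / qpoch_inf q q ^ (N - 1))"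
proof (cases "q = 0")
  case False
  define as where "as n = n + (1 + nat \<bar>l\<bar>)" for n
  have as: "filterlim as at_top sequentially"
    unfolding as_def [abs_def] by (rule filterlim_add_const_nat_at_top)
  have Nas: "filterlim (\<lambda>n. N * as n) at_top sequentially"
  proof (rule filterlim_at_top_mono[OF as])
    show "\<forall>\<^sub>F n in sequentially. as n \<le> N * as n" using i by simp
  qed
  show ?thesis
  proof (rule su_avg_theta_limit[of i N l as "\<lambda>_. q" "norm q"])
    show "(\<lambda>n. theta_prod N (as n) i l q x) \<longlonglongrightarrow> theta_inf N q x" for x
      by (rule theta_prod_tendsto[OF q as])
    have "(\<lambda>n. q powi wilson_exponent N i l * (qpoch q q (N * as n) / qpoch q q (as n) ^ N)) \<longlonglongrightarrow>
      q powi wilson_exponent N i l * (qpoch_inf q q / qpoch_inf q q ^ N)"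
      using qpoch_inf_nonzero[OF q] by (intro tendsto_intros qpoch_tendsto_compose q as Nas) auto
    also have "qpoch_inf q q / qpoch_inf q q ^ N = 1 / qpoch_inf q q ^ (N - 1)"
      using qpoch_inf_nonzero[OF q] i by (cases N) auto
    finally show "(\<lambda>n. q powi wilson_exponent N i l * (qpoch q q (N * as n) / qpoch q q (as n) ^ N)) \<longlonglongrightarrow>
      q ^ nat (wilson_exponent N i l) / qpoch_inf q q ^ (N - 1)"
      by (simp add: power_int_def wilson_exponent_nonneg)
  qed (use q i False in \<open>auto simp: as_def\<close>)
next
  case True
  \<comment> \<open>The shift argument divides by \<open>q\<close>. At \<open>q = 0\<close> the truncation is already exact for
    large \<open>a\<close>, so \<open>a\<close> stays fixed and \<open>q\<close> tends to \<open>0\<close> instead.\<close>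
  define a where "a = 1 + nat \<bar>l\<bar>"
  \<comment> \<open>The values 1 / (n + 2) are nonzero and at most 1 / 2, which gives a uniform
    bound.\<close>
  define qs :: "nat \<Rightarrow> complex" where "qs n = of_real (inverse (real (Suc (Suc n))))" for n
  have qs: "qs \<longlonglongrightarrow> 0"
    unfolding qs_def [abs_def]
    using tendsto_of_real[OF LIMSEQ_Suc[OF LIMSEQ_inverse_real_of_nat], where 'a = complex]
    by (simp only: of_real_0)
  have qpoch_lim: "(\<lambda>n. qpoch (f n) (qs n) k) \<longlonglongrightarrow> qpoch u 0 k" if "f \<longlonglongrightarrow> u" for f u k
    unfolding qpoch_def by (intro tendsto_intros qs that)
  show ?thesis unfolding True
  proof (rule su_avg_theta_limit[of i N l "\<lambda>_. a" qs "1 / 2"])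
    show "(\<lambda>n. theta_prod N a i l (qs n) x) \<longlonglongrightarrow> theta_inf N 0 x" if x: "on_su N x" for x
    proof -
      have nz: "x p \<noteq> 0" if "p < N" for p using x that by (auto simp: on_su_def)
      have "(\<lambda>n. theta_prod N a i l (qs n) x) \<longlonglongrightarrow> theta_prod N a i l 0 x"
        unfolding theta_prod_def qtheta_def
        using nz by (intro tendsto_prod tendsto_mult qpoch_lim tendsto_divide tendsto_const qs) auto
      \<comment> \<open>The choice of \<open>a\<close> keeps all lengths at least 1, and
        \<open>(u; 0)_n\<close> is 1 - u for every such length, as is the infinite product.\<close>
      also have "theta_prod N a i l 0 x = theta_inf N 0 x"
        unfolding theta_prod_def theta_inf_def qtheta_def
        by (intro prod.cong refl arg_cong2[where f = "(*)"])
           (simp_all add: qpoch_at_0 qpoch_inf_at_0 a_def pair_shift_def)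
      finally show ?thesis .
    qed
    have "(\<lambda>n. qs n ^ nat (wilson_exponent N i l) * (qpoch (qs n) (qs n) (N * a) / qpoch (qs n) (qs n) a ^ N)) \<longlonglongrightarrow>
      0 ^ nat (wilson_exponent N i l) * (qpoch 0 0 (N * a) / qpoch 0 0 a ^ N)"
      using qpoch_nonzero[of 0] by (intro tendsto_intros qpoch_lim qs) auto
    then show "(\<lambda>n. qs n powi wilson_exponent N i l * (qpoch (qs n) (qs n) (N * a) / qpoch (qs n) (qs n) a ^ N)) \<longlonglongrightarrow>
      0 ^ nat (wilson_exponent N i l) / qpoch_inf 0 0 ^ (N - 1)"
      by (simp add: power_int_def wilson_exponent_nonneg qpoch_inf_at_0 qpoch_def)
    show "norm (qs n) \<le> 1 / 2" for n
      unfolding qs_def norm_of_real by (simp add: divide_simps)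
    show "qs n \<noteq> 0" for n unfolding qs_def by (simp del: of_nat_Suc)
  qed (use i in \<open>auto simp: a_def\<close>)
qed

text \<open>Here the exponent \<open>m\<close> is arbitrary. The degrees are congruent to
  \<open>m\<close> modulo N, which gives the vanishing case; the approximants also carry
  \<open>su_avg_perm\<close> to the infinite product.\<close>

lemma theta_inf_approx:
  assumes q: "norm q < 1" and i: "i < N"
  obtains h D B where "\<And>n. homog N (D n) (h n)" "\<And>n x. on_su N x \<Longrightarrow> norm (h n x) \<le> B"
    "\<And>x. on_su N x \<Longrightarrow> (\<lambda>n. h n x) \<longlonglongrightarrow> x i powi m * theta_inf N q x"
    "\<And>n. N dvd D n \<Longrightarrow> int N dvd m"
proof
  define K where "K = nat \<bar>m\<bar>"
  define e where "e j = (if j = i then nat (m + int K) else K)" for j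
  define h where "h n x = (\<Prod>j<N. x j ^ e j) * dyson N n q x" for n x
  define D where "D n = (\<Sum>j<N. e j) + N * ((N - 1) * n)" for n
  \<comment> \<open>Negative powers of \<open>x i\<close> become polynomial after multiplying by \<open>K\<close>-th powers of
    \<open>\<Prod>j<N. x j\<close>, which is 1 on the torus.\<close>
  show "homog N (D n) (h n)" for n
    unfolding h_def [abs_def] D_def by (intro homog_mult homog_monom homog_dyson)
  have h: "h n x = x i powi m * theta_prod N n i 0 q x" if x: "on_su N x" for n x
  proof -
    have nz: "x p \<noteq> 0" if "p < N" for p using x that by (auto simp: on_su_def)
    have "(\<Prod>j<N. x j ^ e j) = (\<Prod>j<N. (if j = i then x i powi m else 1) * x j ^ K)"
    proof (intro prod.cong refl)
      fix j assume "j \<in> {..<N}"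
      have "x i ^ nat (m + int K) = x i powi (m + int K)" by (simp add: power_int_def K_def)
      also have "\<dots> = x i powi m * x i ^ K" using nz[OF i] by (simp add: power_int_add)
      finally show "x j ^ e j = (if j = i then x i powi m else 1) * x j ^ K"
        by (simp add: e_def)
    qed
    also have "\<dots> = x i powi m * (\<Prod>j<N. x j) ^ K"
      using i by (simp add: prod.distrib prod_power_distrib)
    finally have "(\<Prod>j<N. x j ^ e j) = x i powi m" using x by (simp add: on_su_def)
    moreover have "dyson N n q x = theta_prod N n i 0 q x"
      using dyson_eq_theta_prod[of N x n q i] nz x by (simp add: on_su_def)
    ultimately show ?thesis by (simp add: h_def)
  qed
  show "norm (h n x) \<le> (\<Prod>p<N. \<Prod>s\<in>{p<..<N}. exp (1 / (1 - norm q)) * exp (1 / (1 - norm q)))"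
    if "on_su N x" for n x
    using norm_theta_prod_le[OF that order_refl q] that i
    by (simp add: h[OF that] norm_mult norm_power_int on_su_def)
  show "(\<lambda>n. h n x) \<longlonglongrightarrow> x i powi m * theta_inf N q x" if "on_su N x" for x
    unfolding h[OF that] by (intro tendsto_intros theta_prod_tendsto[OF q filterlim_ident])
  show "int N dvd m" if "N dvd D n" for n
  proof -
    have "int (\<Sum>j<N. e j) = (\<Sum>j<N. int K + (if j = i then m else 0))"
      unfolding of_nat_sum by (intro sum.cong) (auto simp: e_def K_def)
    also have "\<dots> = int N * int K + m" using i by (simp add: sum.distrib)
    finally have "int (D n) = int N * int K + m + int N * int ((N - 1) * n)"
      unfolding D_def of_nat_add of_nat_mult by simp
    moreover have "int N dvd int (D n)" using that by simp
    ultimately show ?thesis by (simp add: dvd_add_left_iff dvd_add_right_iff)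
  qed
qed

lemma su_avg_theta_inf_zero:
  assumes q: "norm q < 1" and i: "i < N" and m: "\<not> int N dvd m"
  shows "su_avg N (\<lambda>x. x i powi m * theta_inf N q x) = 0"
proof -
  have N: "N \<ge> 1" using i by simp
  obtain h D B where h: "\<And>n. homog N (D n) (h n)" "\<And>n x. on_su N x \<Longrightarrow> norm (h n x) \<le> B"
    "\<And>x. on_su N x \<Longrightarrow> (\<lambda>n. h n x) \<longlonglongrightarrow> x i powi m * theta_inf N q x"
    "\<And>n. N dvd D n \<Longrightarrow> int N dvd m"
    using theta_inf_approx[OF q i] by metis
  have "su_avg N (h n) = 0" for n
    using su_avg_zero_degree[OF h(1) _ N] h(4) m by blast
  with su_avg_limit(1)[OF N h(1,2,3)] show ?thesis by (simp add: LIMSEQ_const_iff)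
qed

lemma on_su_perm:
  assumes "on_su N x" "xs \<in> permutations_of_set {..<N}"
  shows "on_su N (\<lambda>i. x (xs ! i))"
  using assms(1) bij_betw_perm_nth[OF assms(2)] prod.reindex_bij_betw[OF bij_betw_perm_nth[OF assms(2)], of x]
  by (auto simp: on_su_def bij_betw_def)

lemma su_avg_theta_inf_perm:
  assumes q: "norm q < 1" and i: "i < N" and xs: "xs \<in> permutations_of_set {..<N}"
  shows "su_avg N (\<lambda>x. x (xs ! i) powi m * theta_inf N q (\<lambda>i. x (xs ! i))) =
      su_avg N (\<lambda>x. x i powi m * theta_inf N q x)"
    and "integrable (angle_measure N)
      (\<lambda>\<theta>. torus_pt N \<theta> (xs ! i) powi m * theta_inf N q (\<lambda>i. torus_pt N \<theta> (xs ! i)))"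
proof -
  have N: "N \<ge> 1" using i by simp
  obtain h D B where h: "\<And>n. homog N (D n) (h n)" "\<And>n x. on_su N x \<Longrightarrow> norm (h n x) \<le> B"
    "\<And>x. on_su N x \<Longrightarrow> (\<lambda>n. h n x) \<longlonglongrightarrow> x i powi m * theta_inf N q x"
    using theta_inf_approx[OF q i] by metis
  note lim = su_avg_limit[where h = "\<lambda>n x. h n (\<lambda>i. x (xs ! i))" and B = B and D = D and
      f = "\<lambda>x. x (xs ! i) powi m * theta_inf N q (\<lambda>i. x (xs ! i))", OF N homog_perm[OF h(1) xs]
      h(2)[OF on_su_perm[OF _ xs]] h(3)[OF on_su_perm[OF _ xs]]]
  show "integrable (angle_measure N)
      (\<lambda>\<theta>. torus_pt N \<theta> (xs ! i) powi m * theta_inf N q (\<lambda>i. torus_pt N \<theta> (xs ! i)))"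
    by (rule lim(2))
  show "su_avg N (\<lambda>x. x (xs ! i) powi m * theta_inf N q (\<lambda>i. x (xs ! i))) =
      su_avg N (\<lambda>x. x i powi m * theta_inf N q x)"
    using lim(1) su_avg_limit(1)[OF N h(1,2,3)] unfolding su_avg_perm[OF h(1) N xs]
    by (rule LIMSEQ_unique)
qed

section \<open>Symmetrisation of the density\<close>

text \<open>The ratio of one ordered theta product to the symmetric density. Lists allow summation
  over \<open>permutations_of_set\<close> and splitting at the head.\<close>

definition pair_weight :: "complex list \<Rightarrow> complex" where
  "pair_weight ys = (\<Prod>p<length ys. \<Prod>r\<in>{p<..<length ys}. ys ! p / (ys ! p - ys ! r))"

lemma pair_weight_Cons:
  assumes "distinct cs"
  shows "pair_weight (c # cs) = (\<Prod>b\<in>set cs. c / (c - b)) * pair_weight cs"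
proof -
  let ?n = "length cs"
  have "(\<Prod>r\<in>{0<..<Suc ?n}. c / (c - (c # cs) ! r)) = (\<Prod>r<?n. c / (c - cs ! r))"
    by (rule prod.reindex_bij_witness[of _ Suc "\<lambda>r. r - 1"]) auto
  also have "\<dots> = (\<Prod>b\<in>set cs. c / (c - b))"
    by (rule prod.reindex_bij_betw) (rule bij_betw_nth, use assms in auto)
  finally have "(\<Prod>r\<in>{0<..<Suc ?n}. c / (c - (c # cs) ! r)) = (\<Prod>b\<in>set cs. c / (c - b))" .
  moreover have "(\<Prod>r\<in>{Suc p<..<Suc ?n}. cs ! p / (cs ! p - (c # cs) ! r)) =
      (\<Prod>r\<in>{p<..<?n}. cs ! p / (cs ! p - cs ! r))" for p
    by (rule prod.reindex_bij_witness[of _ Suc "\<lambda>r. r - 1"]) auto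
  ultimately show ?thesis
    unfolding pair_weight_def by (simp add: prod.lessThan_Suc_shift del: prod.lessThan_Suc)
qed

text \<open>Group the orderings by their first element \<open>c\<close>. The rest sums to 1 by
  induction, and what is left is the divided difference of z^d at d + 1 nodes, which is 1.\<close>

lemma sum_pair_weight:
  assumes "finite A"
  shows "(\<Sum>ys\<in>permutations_of_set A. pair_weight ys) = 1"
  using assms
proof (induction A rule: finite_psubset_induct)
  case (psubset A)
  show ?case
  proof (cases "A = {}")
    case True
    then show ?thesis by (simp add: pair_weight_def)
  next
    case False
    then obtain d where d: "card A = Suc d"
      using psubset.hyps by (metis card_0_eq not0_implies_Suc)
    have "(\<Sum>ys\<in>permutations_of_set A. pair_weight ys) =
        (\<Sum>c\<in>A. \<Sum>ys\<in>(#) c ` permutations_of_set (A - {c}). pair_weight ys)"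
      unfolding permutations_of_set_nonempty[OF False]
      by (rule sum.UNION_disjoint) (use psubset.hyps in auto)
    also have "\<dots> = (\<Sum>c\<in>A. (\<Prod>b\<in>A - {c}. c / (c - b)) *
        (\<Sum>cs\<in>permutations_of_set (A - {c}). pair_weight cs))"
    proof (intro sum.cong refl)
      fix c assume "c \<in> A"
      have "(\<Sum>ys\<in>(#) c ` permutations_of_set (A - {c}). pair_weight ys) =
          (\<Sum>cs\<in>permutations_of_set (A - {c}). pair_weight (c # cs))"
        by (simp add: sum.reindex)
      also have "\<dots> = (\<Sum>cs\<in>permutations_of_set (A - {c}).
          (\<Prod>b\<in>A - {c}. c / (c - b)) * pair_weight cs)"
        by (intro sum.cong refl) (simp add: pair_weight_Cons permutations_of_setD)
      finally show "(\<Sum>ys\<in>(#) c ` permutations_of_set (A - {c}). pair_weight ys) =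
          (\<Prod>b\<in>A - {c}. c / (c - b)) * (\<Sum>cs\<in>permutations_of_set (A - {c}). pair_weight cs)"
        by (simp add: sum_distrib_left)
    qed
    also have "\<dots> = (\<Sum>c\<in>A. c ^ d / (\<Prod>b\<in>A - {c}. c - b))"
    proof (intro sum.cong refl)
      fix c assume c: "c \<in> A"
      then have "(\<Sum>cs\<in>permutations_of_set (A - {c}). pair_weight cs) = 1"
        by (intro psubset.IH) auto
      moreover have "card (A - {c}) = d" using c d psubset.hyps by simp
      ultimately show "(\<Prod>b\<in>A - {c}. c / (c - b)) *
          (\<Sum>cs\<in>permutations_of_set (A - {c}). pair_weight cs) = c ^ d / (\<Prod>b\<in>A - {c}. c - b)"
        by (simp add: prod_dividef)
    qed
    also have "\<dots> = 1" using divided_difference_power[OF d, of d] by simp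
    finally show ?thesis .
  qed
qed

definition weyl_density :: "nat \<Rightarrow> complex \<Rightarrow> (nat \<Rightarrow> complex) \<Rightarrow> complex" where
  "weyl_density N q x = (\<Prod>i<N. \<Prod>j\<in>{..<N} - {i}. qpoch_inf (x i / x j) q)"

lemma weyl_density_perm:
  assumes "xs \<in> permutations_of_set {..<N}"
  shows "weyl_density N q (\<lambda>i. x (xs ! i)) = weyl_density N q x"
proof -
  let ?p = "\<lambda>i. xs ! i"
  have b: "bij_betw ?p {..<N} {..<N}" by (rule bij_betw_perm_nth[OF assms])
  have "weyl_density N q x = (\<Prod>i<N. \<Prod>j\<in>{..<N} - {?p i}. qpoch_inf (x (?p i) / x j) q)"
    unfolding weyl_density_def by (rule prod.reindex_bij_betw[OF b, symmetric])
  also have "\<dots> = (\<Prod>i<N. \<Prod>j\<in>{..<N} - {i}. qpoch_inf (x (?p i) / x (?p j)) q)"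
  proof (rule prod.cong[OF refl])
    fix i assume i: "i \<in> {..<N}"
    have "bij_betw ?p ({..<N} - {i}) ({..<N} - {?p i})"
      using b i bij_betwE[OF b] by (intro bij_betw_DiffI) auto
    then show "(\<Prod>j\<in>{..<N} - {?p i}. qpoch_inf (x (?p i) / x j) q) =
        (\<Prod>j\<in>{..<N} - {i}. qpoch_inf (x (?p i) / x (?p j)) q)"
      by (rule prod.reindex_bij_betw[symmetric])
  qed
  finally show ?thesis by (simp add: weyl_density_def)
qed

text \<open>For p < r, splitting the head off \<open>(y r / y p; q)_inf\<close> leaves
  \<open>(q y r / y p; q)_inf\<close>, the second half of a theta factor.\<close>

lemma weyl_density_eq_theta_inf:
  assumes q: "norm q < 1" and nz: "\<And>i. i < N \<Longrightarrow> y i \<noteq> 0"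
  shows "weyl_density N q y = theta_inf N q y * (\<Prod>p<N. \<Prod>r\<in>{p<..<N}. 1 - y r / y p)"
proof -
  have "weyl_density N q y = (\<Prod>i<N. (\<Prod>j\<in>{i<..<N}. qpoch_inf (y i / y j) q) * (\<Prod>j<i. qpoch_inf (y i / y j) q))"
    unfolding weyl_density_def
  proof (intro prod.cong refl)
    fix i assume "i \<in> {..<N}"
    then have "{..<N} - {i} = {i<..<N} \<union> {..<i}" by auto
    moreover have "{i<..<N} \<inter> {..<i} = {}" by auto
    ultimately show "(\<Prod>j\<in>{..<N} - {i}. qpoch_inf (y i / y j) q) =
        (\<Prod>j\<in>{i<..<N}. qpoch_inf (y i / y j) q) * (\<Prod>j<i. qpoch_inf (y i / y j) q)"
      by (simp add: prod.union_disjoint)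
  qed
  also have "\<dots> = (\<Prod>p<N. \<Prod>r\<in>{p<..<N}. qpoch_inf (y p / y r) q * qpoch_inf (y r / y p) q)"
    using prod_upper_swap[of "\<lambda>p r. qpoch_inf (y r / y p) q" N] by (simp add: prod.distrib)
  also have "\<dots> = (\<Prod>p<N. \<Prod>r\<in>{p<..<N}.
      (qpoch_inf (y p / y r) q * qpoch_inf (q / (y p / y r)) q) * (1 - y r / y p))"
    by (intro prod.cong refl) (simp add: qpoch_inf_head[OF q, of "y _ / y _"] mult_ac)
  finally show ?thesis by (simp add: theta_inf_def prod.distrib)
qed

text \<open>When two coordinates of \<open>x\<close> coincide, both sides vanish: each ordered product
  contains \<open>(1; q)\<^sub>\<infinity> = 0\<close>. So no almost-everywhere argument is needed.\<close>
lemma weyl_density_symmetrise: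
  assumes q: "norm q < 1" and x: "on_su N x"
  shows "weyl_density N q x = (\<Sum>xs\<in>permutations_of_set {..<N}. theta_inf N q (\<lambda>i. x (xs ! i)))"
proof (cases "inj_on x {..<N}")
  case True
  have "theta_inf N q (\<lambda>i. x (xs ! i)) = weyl_density N q x * pair_weight (map x xs)"
    if xs: "xs \<in> permutations_of_set {..<N}" for xs
  proof -
    define y where "y i = x (xs ! i)" for i
    have len: "length xs = N"
      using xs by (metis card_lessThan distinct_card permutations_of_setD)
    have b: "bij_betw (\<lambda>i. xs ! i) {..<N} {..<N}" by (rule bij_betw_perm_nth[OF xs])
    have nz: "y p \<noteq> 0" if "p < N" for p
      using on_su_perm[OF x xs] that by (auto simp: on_su_def y_def)
    have "inj_on y {..<N}"
      unfolding y_def using comp_inj_on[of "\<lambda>i. xs ! i" "{..<N}" x] b True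
      by (simp add: bij_betw_def o_def)
    then have ne: "y p \<noteq> y r" if "p < N" "r < N" "p < r" for p r
      using that by (auto dest: inj_onD)
    \<comment> \<open>The factors of \<open>pair_weight\<close> are the inverses of the factors
      \<open>1 - y r / y p\<close> by which density and theta product differ.\<close>
    have "pair_weight (map x xs) = (\<Prod>p<N. \<Prod>r\<in>{p<..<N}. y p / (y p - y r))"
      unfolding pair_weight_def y_def by (intro prod.cong) (auto simp: len)
    also have "\<dots> = (\<Prod>p<N. \<Prod>r\<in>{p<..<N}. 1 / (1 - y r / y p))"
      using nz by (intro prod.cong refl) (simp add: divide_simps)
    finally have "pair_weight (map x xs) * (\<Prod>p<N. \<Prod>r\<in>{p<..<N}. 1 - y r / y p) =
        (\<Prod>p<N. \<Prod>r\<in>{p<..<N}. 1 / (1 - y r / y p) * (1 - y r / y p))"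
      by (simp only: prod.distrib)
    also have "\<dots> = 1"
      using nz ne by (intro prod.neutral ballI) (auto simp: divide_simps)
    finally have "theta_inf N q y = weyl_density N q y * pair_weight (map x xs)"
      using weyl_density_eq_theta_inf[OF q, of N y] nz by (simp add: mult_ac)
    then show ?thesis
      using weyl_density_perm[OF xs, of q x] by (simp add: y_def [abs_def])
  qed
  then have "(\<Sum>xs\<in>permutations_of_set {..<N}. theta_inf N q (\<lambda>i. x (xs ! i))) =
      weyl_density N q x * (\<Sum>xs\<in>permutations_of_set {..<N}. pair_weight (map x xs))"
    by (simp add: sum_distrib_left)
  \<comment> \<open>As \<open>x\<close> is injective, orderings of the indices correspond to
    orderings of the values, to which \<open>sum_pair_weight\<close> applies.\<close>
  also have "(\<Sum>xs\<in>permutations_of_set {..<N}. pair_weight (map x xs)) =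
      (\<Sum>ys\<in>map x ` permutations_of_set {..<N}. pair_weight ys)"
  proof (rule sum.reindex[symmetric, unfolded o_def])
    show "inj_on (map x) (permutations_of_set {..<N})"
    proof (rule inj_onI)
      fix xs ys assume *: "xs \<in> permutations_of_set {..<N}" "ys \<in> permutations_of_set {..<N}"
        "map x xs = map x ys"
      then have "set xs \<union> set ys = {..<N}" by (simp add: permutations_of_setD)
      then show "xs = ys" using map_inj_on[OF *(3)] True by simp
    qed
  qed
  also have "\<dots> = 1"
    using True by (simp add: permutations_of_set_image_inj[symmetric] sum_pair_weight)
  finally show ?thesis by simp
next
  case False
  then obtain i j where ij: "i < N" "j < N" "i \<noteq> j" "x i = x j" by (auto simp: inj_on_def)
  have nz: "x p \<noteq> 0" if "p < N" for p using x that by (auto simp: on_su_def)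
  have "(\<Prod>j\<in>{..<N} - {i}. qpoch_inf (x i / x j) q) = 0"
    using ij nz[of j] by - (rule prod_zero, simp, rule bexI[of _ j], simp_all add: qpoch_inf_one[OF q])
  then have "weyl_density N q x = 0"
    unfolding weyl_density_def using ij(1) by - (rule prod_zero, simp, rule bexI[of _ i], simp_all)
  moreover have "theta_inf N q (\<lambda>i. x (xs ! i)) = 0" if xs: "xs \<in> permutations_of_set {..<N}" for xs
  proof -
    have "(\<lambda>i. xs ! i) ` {..<N} = {..<N}"
      using bij_betw_perm_nth[OF xs] by (simp add: bij_betw_def)
    then obtain i' j' where *: "i' < N" "j' < N" "i = xs ! i'" "j = xs ! j'"
      using ij by (metis (no_types, lifting) imageE lessThan_iff)
    then obtain p r where pr: "p < r" "r < N" "x (xs ! p) = x (xs ! r)" "x (xs ! r) \<noteq> 0"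
      using ij nz by (metis linorder_neqE_nat)
    have "(\<Prod>r\<in>{p<..<N}. qpoch_inf (x (xs ! p) / x (xs ! r)) q *
        qpoch_inf (q / (x (xs ! p) / x (xs ! r))) q) = 0"
      using pr by - (rule prod_zero, simp, rule bexI[of _ r], simp_all add: qpoch_inf_one[OF q])
    then show ?thesis
      unfolding theta_inf_def using pr by - (rule prod_zero, simp, rule bexI[of _ p], simp_all)
  qed
  ultimately show ?thesis by simp
qed

section \<open>Assembling the Wilson loop average\<close>

lemma su_avg_weyl_density:
  assumes q: "norm q < 1" and N: "N \<ge> 1"
  shows "su_avg N (\<lambda>x. weyl_density N q x * (\<Sum>i<N. x i powi m)) =
    fact N * (\<Sum>i<N. su_avg N (\<lambda>x. x i powi m * theta_inf N q x))"
proof -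
  let ?f = "\<lambda>xs i x. x (xs ! i) powi m * theta_inf N q (\<lambda>i. x (xs ! i))"
  have "su_avg N (\<lambda>x. weyl_density N q x * (\<Sum>i<N. x i powi m)) =
      su_avg N (\<lambda>x. \<Sum>xs\<in>permutations_of_set {..<N}. \<Sum>i<N. ?f xs i x)"
  proof (rule su_avg_cong[OF N])
    fix x assume x: "on_su N x"
    have "theta_inf N q (\<lambda>i. x (xs ! i)) * (\<Sum>i<N. x i powi m) = (\<Sum>i<N. ?f xs i x)"
      if xs: "xs \<in> permutations_of_set {..<N}" for xs
    proof -
      \<comment> \<open>The power sum is symmetric, so it can be relabelled by the same ordering as
        the theta product.\<close>
      have "(\<Sum>i<N. x i powi m) = (\<Sum>i<N. x (xs ! i) powi m)"
        by (rule sum.reindex_bij_betw[OF bij_betw_perm_nth[OF xs], symmetric])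
      then show ?thesis by (simp add: sum_distrib_left mult.commute)
    qed
    then show "weyl_density N q x * (\<Sum>i<N. x i powi m) =
        (\<Sum>xs\<in>permutations_of_set {..<N}. \<Sum>i<N. ?f xs i x)"
      unfolding weyl_density_symmetrise[OF q x] sum_distrib_right by (intro sum.cong refl)
  qed
  also have "\<dots> = (\<Sum>xs\<in>permutations_of_set {..<N}. \<Sum>i<N. su_avg N (?f xs i))"
  proof -
    have int: "integrable (angle_measure N) (\<lambda>\<theta>. ?f xs i (torus_pt N \<theta>))"
      if "xs \<in> permutations_of_set {..<N}" "i \<in> {..<N}" for xs i
      using su_avg_theta_inf_perm(2)[OF q _ that(1)] that(2) by blast
    have "integral\<^sup>L (angle_measure N)
          (\<lambda>\<theta>. \<Sum>xs\<in>permutations_of_set {..<N}. \<Sum>i<N. ?f xs i (torus_pt N \<theta>)) =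
        (\<Sum>xs\<in>permutations_of_set {..<N}. integral\<^sup>L (angle_measure N)
          (\<lambda>\<theta>. \<Sum>i<N. ?f xs i (torus_pt N \<theta>)))"
      by (intro Bochner_Integration.integral_sum Bochner_Integration.integrable_sum int)
    also have "\<dots> = (\<Sum>xs\<in>permutations_of_set {..<N}. \<Sum>i<N.
        integral\<^sup>L (angle_measure N) (\<lambda>\<theta>. ?f xs i (torus_pt N \<theta>)))"
      by (intro sum.cong refl Bochner_Integration.integral_sum int)
    finally show ?thesis unfolding su_avg_def by (simp only: sum_distrib_left)
  qed
  \<comment> \<open>Every ordering gives the same average; their number N! will cancel the
    normalisation 1 / N!.\<close>
  also have "\<dots> = (\<Sum>xs\<in>permutations_of_set {..<N}. \<Sum>i<N. su_avg N (\<lambda>x. x i powi m * theta_inf N q x))"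
    by (intro sum.cong refl su_avg_theta_inf_perm(1) q) auto
  also have "\<dots> = fact N * (\<Sum>i<N. su_avg N (\<lambda>x. x i powi m * theta_inf N q x))"
    by simp
  finally show ?thesis .
qed

text \<open>Since \<open>l * (l + 1) div 2\<close> exceeds \<open>l * (l - 1) div 2\<close> by
  \<open>l\<close>, the exponents for the N values of \<open>i\<close> form an arithmetic
  progression, whose powers of q sum to the quotient in the formula.\<close>

lemma wilson_exponent_eq:
  assumes "i < N"
  shows "wilson_exponent N i l = (int N - 1) * l * (l - 1) div 2 + int (N - Suc i) * l"
proof -
  define A where "A = l * (l - 1) div 2"
  have A: "l * (l - 1) = 2 * A" unfolding A_def by simp
  have "l * (l + 1) = 2 * (A + l)" using A by (simp add: algebra_simps)
  then have 1: "l * (l + 1) div 2 = A + l" by simp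
  have "(int N - 1) * l * (l - 1) = 2 * ((int N - 1) * A)"
    unfolding mult.assoc A by (rule mult.left_commute)
  then have 2: "(int N - 1) * l * (l - 1) div 2 = (int N - 1) * A"
    by (metis nonzero_mult_div_cancel_left zero_neq_numeral)
  show ?thesis
    unfolding wilson_exponent_def 1 2 A_def[symmetric] using assms
    by (simp add: algebra_simps)
qed

text \<open>The quotient is expanded into its N powers of q, which includes \<open>l = 0\<close>. As
  \<open>int k * l\<close> may be negative it is added before \<open>nat\<close> is applied; the
  total is a value of \<open>wilson_exponent\<close>, hence nonnegative.\<close>

theorem theorem1p2:
  fixes N :: nat and m :: int and q :: complex
  assumes "N \<ge> 2" and "norm q < 1"
  shows "wilson_SU_minusN N m q =
    (if int N dvd m then
       (let l = m div int N in
         (-1) powi (l * (int N - 1)) *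
         (\<Sum>k<N. q ^ nat ((int N - 1) * l * (l - 1) div 2 + int k * l)))
     else 0)"
proof -
  define Q where "Q = qpoch_inf q q"
  have Q: "Q \<noteq> 0" unfolding Q_def by (rule qpoch_inf_nonzero[OF assms(2)])
  have N: "N \<ge> 1" using assms(1) by simp
  have "wilson_SU_minusN N m q = Q ^ (N - 1) / fact N *
      su_avg N (\<lambda>x. weyl_density N q x * (\<Sum>i<N. x i powi m))"
    by (simp add: wilson_SU_minusN_def wilson_integrand_def [abs_def] su_avg_def weyl_density_def
        Q_def Let_def)
  also have "\<dots> = Q ^ (N - 1) * (\<Sum>i<N. su_avg N (\<lambda>x. x i powi m * theta_inf N q x))"
    unfolding su_avg_weyl_density[OF assms(2) N] by simp
  finally have W: "wilson_SU_minusN N m q =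
      Q ^ (N - 1) * (\<Sum>i<N. su_avg N (\<lambda>x. x i powi m * theta_inf N q x))" .
  show ?thesis
  proof (cases "int N dvd m")
    case False
    then show ?thesis using su_avg_theta_inf_zero[OF assms(2) _ False] by (simp add: W)
  next
    case True
    define l where "l = m div int N"
    have m: "m = l * int N" using True by (simp add: l_def)
    have "wilson_SU_minusN N m q =
        Q ^ (N - 1) * (\<Sum>i<N. (-1) powi (l * (int N - 1)) * (q ^ nat (wilson_exponent N i l) / Q ^ (N - 1)))"
      unfolding W unfolding m Q_def
      by (intro arg_cong2[where f = "(*)"] sum.cong refl su_avg_theta_inf assms(2)) simp
    also have "\<dots> = (-1) powi (l * (int N - 1)) * (\<Sum>i<N. q ^ nat (wilson_exponent N i l))"
      using Q by (simp add: sum_distrib_left)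
    also have "(\<Sum>i<N. q ^ nat (wilson_exponent N i l)) =
        (\<Sum>i<N. q ^ nat ((int N - 1) * l * (l - 1) div 2 + int (N - Suc i) * l))"
      by (intro sum.cong refl) (simp add: wilson_exponent_eq)
    also have "\<dots> = (\<Sum>k<N. q ^ nat ((int N - 1) * l * (l - 1) div 2 + int k * l))"
      by (rule sum.nat_diff_reindex)
    finally show ?thesis using True by (simp add: l_def Let_def)
  qed
qed

end
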